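(* Let $\overline{\mathcal{X}}\in\mathbb{X}$ be a stationary point of problem (P) and let $(\overline{\lambda},\overline{\mathcal{Y}})\in\mathcal{M}(\overline{\mathcal{X}})$. Suppose that (1) the second-order sufficient condition holds at $\overline{\mathcal{X}}$, i.e. \[ \sup_{(\lambda,\mathcal{Y})\in\mathcal{M}(\overline{\mathcal{X}})}\Big\{\big\langle \mathcal{Z},\nabla^2_{\mathcal{X}\mathcal{X}}L(\overline{\mathcal{X}};\lambda,\mathcal{Y})\mathcal{Z}\big\rangle-\sigma\big(\mathcal{Y},\mathcal{T}^2_K(G(\overline{\mathcal{X}}),G'(\overline{\mathcal{X}})\mathcal{Z})\big)\Big\}>0\quad\text{for all }\mathcal{Z}\in\mathcal{C}(\overline{\mathcal{X}})\setminus\{0\}; \] (2) $(\overline{\lambda},\overline{\mathcal{Y}})$ satisfies the strict Robinson constraint qualification \[ \begin{pmatrix}h'(\overline{\mathcal{X}})\\ G'(\overline{\mathcal{X}})\end{pmatrix}\mathbb{X}+\begin{pmatrix}\{0\}\\ \mathcal{T}_K(G(\overline{\mathcal{X}}))\cap\overline{\mathcal{Y}}^{\perp}\end{pmatrix}=\begin{pmatrix}\mathbb{R}^p\\ \mathbb{X}\end{pmatrix}. \] Then both multifunctions $\mathcal{J}$ and $\widetilde{\mathcal{J}}$ are locally upper Lipschitz at the origin $0\in\mathbb{X}\times\mathbb{R}^p\times\mathbb{X}$ for $(\overline{\mathcal{X}},\overline{\lambda},\overline{\mathcal{Y}})$.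
   Context: Let $m\le n$ and $1\le k\le m$ be integers, $\mathbb{X}=\mathbb{R}\times\mathbb{R}^{m\times n}$ with inner product $\langle(t,X),(s,Y)\rangle=ts+\mathrm{tr}(X^{T}Y)$ and induced norm. For $X\in\mathbb{R}^{m\times n}$ let $\sigma_1(X)\ge\dots\ge\sigma_m(X)$ be its singular values. The Ky Fan $k$-norm matrix cone is $K=\{(t,X)\in\mathbb{X}:\sum_{i=1}^k\sigma_i(X)\le t\}$, a closed convex cone; $K^\circ$ is its polar cone, $\Pi_K$ the Euclidean projection onto $K$, $\mathcal{N}_K$ the normal cone of convex analysis, $\mathcal{T}_K(x)$ the contingent (tangent) cone at $x\in K$, and $\mathcal{T}^2_K(x,d)=\{w:\mathrm{dist}(x+td+\tfrac12t^2w,K)=o(t^2),\ t\downarrow0\}$ the outer second-order tangent set; $\sigma(y,S)=\sup_{w\in S}\langle y,w\rangle$ is the support function. For $\mathcal{Y}\in\mathbb{X}$, $\mathcal{Y}^\perp=\{\mathcal{Z}:\langle\mathcal{Z},\mathcal{Y}\rangle=0\}$. Problem (P): $\min_{\mathcal{X}\in\mathbb{X}}\{f(\mathcal{X}): h(\mathcal{X})=0,\ G(\mathcal{X})\in K\}$ with $f:\mathbb{X}\to\mathbb{R}$, $h:\mathbb{X}\to\mathbb{R}^p$, $G:\mathbb{X}\to\mathbb{X}$ twice continuously differentiable. Lagrangian $L(\mathcal{X};\lambda,\mathcal{Y})=f(\mathcal{X})+\langle h(\mathcal{X}),\lambda\rangle+\langle G(\mathcal{X}),\mathcal{Y}\rangle$.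 For feasible $\overline{\mathcal{X}}$, $\mathcal{M}(\overline{\mathcal{X}})$ is the set of $(\lambda,\mathcal{Y})\in\mathbb{R}^p\times\mathbb{X}$ with $L'_{\mathcal{X}}(\overline{\mathcal{X}};\lambda,\mathcal{Y})=0$ and $\mathcal{Y}\in\mathcal{N}_K(G(\overline{\mathcal{X}}))$; $\overline{\mathcal{X}}$ is stationary if $\mathcal{M}(\overline{\mathcal{X}})\neq\emptyset$. Critical cone: $\mathcal{C}(\overline{\mathcal{X}})=\{\mathcal{Z}: h'(\overline{\mathcal{X}})\mathcal{Z}=0,\ G'(\overline{\mathcal{X}})\mathcal{Z}\in\mathcal{T}_K(G(\overline{\mathcal{X}})),\ \langle f'(\overline{\mathcal{X}}),\mathcal{Z}\rangle=0\}$. Define $\Psi(\mathcal{X},\lambda,\mathcal{Y})=\big(L'_{\mathcal{X}}(\mathcal{X};\lambda,\mathcal{Y}),\,h(\mathcal{X}),\,G(\mathcal{X})-\Pi_K(G(\mathcal{X})+\mathcal{Y})\big)$, and for $\delta=(\delta_f,\delta_h,\delta_G)\in\mathbb{X}\times\mathbb{R}^p\times\mathbb{X}$, $\widetilde{\Psi}(\delta,\mathcal{X},\lambda,\mathcal{Y})=\big(L'_{\mathcal{X}}(\mathcal{X};\lambda,\mathcal{Y})-\delta_f,\,h(\mathcal{X})-\delta_h,\,G(\mathcal{X})-\delta_G-\Pi_K(G(\mathcal{X})-\delta_G+\mathcal{Y})\big)$. Solution maps: $\mathcal{J}(\delta)=\{(\mathcal{X},\lambda,\mathcal{Y}):\Psi(\mathcal{X},\lambda,\mathcal{Y})=\delta\}$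 and $\widetilde{\mathcal{J}}(\delta)=\{(\mathcal{X},\lambda,\mathcal{Y}):\widetilde{\Psi}(\delta,\mathcal{X},\lambda,\mathcal{Y})=0\}$. A multifunction $\mathcal{S}:\mathbb{Y}\rightrightarrows\mathbb{Z}$ between finite-dimensional normed spaces is locally upper Lipschitz at $\overline{y}$ for $\overline{z}\in\mathcal{S}(\overline{y})$ if there exist $\mu\ge0$ and neighborhoods $\mathcal{U}$ of $\overline{y}$, $\mathcal{V}$ of $\overline{z}$ with $\mathcal{V}\cap\mathcal{S}(\overline{y})=\{\overline{z}\}$ and $\mathcal{S}(y)\cap\mathcal{V}\subseteq\{\overline{z}\}+\mu\|y-\overline{y}\|\mathbb{B}$ for all $y\in\mathcal{U}$ ($\mathbb{B}$ the closed unit ball of $\mathbb{Z}$). *)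

theory Defs
  imports "HOL-Analysis.Analysis"
begin

text \<open>The space X = R x R^(m x n); an m x n matrix is an element of real^'n^'m
  (rows indexed by 'm, columns by 'n). The inner product on this type is
  t s + sum_{i,j} X_ij Y_ij = t s + tr(X^T Y), as in the paper.\<close>

type_synonym ('m, 'n) XX = "real \<times> ((real^'n)^'m)"

definition outer_vec :: "real^'m \<Rightarrow> real^'n \<Rightarrow> real^'n^'m" where
  "outer_vec u v = (\<chi> a b. u $ a * v $ b)"

definition is_singular_values :: "real^'n^'m \<Rightarrow> (nat \<Rightarrow> real) \<Rightarrow> bool" where
  "is_singular_values X s \<longleftrightarrow>
     (\<exists>u :: nat \<Rightarrow> real^'m. \<exists>v :: nat \<Rightarrow> real^'n.
        (\<forall>i<CARD('m). \<forall>j<CARD('m). inner (u i) (u j) = (if i = j then 1 else 0)) \<and>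
        (\<forall>i<CARD('m). \<forall>j<CARD('m). inner (v i) (v j) = (if i = j then 1 else 0)) \<and>
        X = (\<Sum>i<CARD('m). s i *\<^sub>R outer_vec (u i) (v i))) \<and>
     (\<forall>i j. i \<le> j \<longrightarrow> j < CARD('m) \<longrightarrow> s j \<le> s i) \<and>
     (\<forall>i<CARD('m). 0 \<le> s i) \<and>
     (\<forall>i. CARD('m) \<le> i \<longrightarrow> s i = 0)"

text \<open>sing_val X i = sigma_{i+1}(X).\<close>
definition sing_val :: "real^'n^'m \<Rightarrow> nat \<Rightarrow> real" where
  "sing_val X = (SOME s. is_singular_values X s)"

definition kyfan_norm :: "nat \<Rightarrow> real^'n^'m \<Rightarrow> real" where
  "kyfan_norm k X = (\<Sum>i<k. sing_val X i)"

definition kyfan_cone :: "nat \<Rightarrow> ('m::finite, 'n::finite) XX set" where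
  "kyfan_cone k = {(t, X). kyfan_norm k X \<le> t}"

definition normal_cone :: "'a::real_inner set \<Rightarrow> 'a \<Rightarrow> 'a set" where
  "normal_cone C x = {y. \<forall>z\<in>C. inner y (z - x) \<le> 0}"

definition tangent_cone :: "'a::real_normed_vector set \<Rightarrow> 'a \<Rightarrow> 'a set" where
  "tangent_cone C x = {d. \<exists>(t::nat \<Rightarrow> real) (dd::nat \<Rightarrow> 'a).
      (\<forall>j. 0 < t j) \<and> t \<longlonglongrightarrow> 0 \<and> dd \<longlonglongrightarrow> d \<and> (\<forall>j. x + t j *\<^sub>R dd j \<in> C)}"

definition second_tangent_set :: "'a::real_normed_vector set \<Rightarrow> 'a \<Rightarrow> 'a \<Rightarrow> 'a set" where
  "second_tangent_set C x d = {w.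
      ((\<lambda>t. infdist (x + t *\<^sub>R d + (t\<^sup>2 / 2) *\<^sub>R w) C / t\<^sup>2) \<longlongrightarrow> 0) (at_right 0)}"

text \<open>Support function, extended-real valued (sup of the empty set is -infinity).\<close>
definition support_fun :: "'a::real_inner \<Rightarrow> 'a set \<Rightarrow> ereal" where
  "support_fun y S = (SUP w\<in>S. ereal (inner y w))"

definition C2_with :: "('a::real_normed_vector \<Rightarrow> 'b::real_normed_vector) \<Rightarrow>
    ('a \<Rightarrow> 'a \<Rightarrow>\<^sub>L 'b) \<Rightarrow> ('a \<Rightarrow> 'a \<Rightarrow>\<^sub>L 'a \<Rightarrow>\<^sub>L 'b) \<Rightarrow> bool" where
  "C2_with F F1 F2 \<longleftrightarrow>
     (\<forall>x. (F has_derivative blinfun_apply (F1 x)) (at x)) \<and>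
     (\<forall>x. (F1 has_derivative blinfun_apply (F2 x)) (at x)) \<and>
     continuous_on UNIV F2"

text \<open>Gradient L'_X(x; lam, Y) of the Lagrangian (Riesz representer w.r.t. the inner product).\<close>
definition lag_grad :: "('a::euclidean_space \<Rightarrow> 'a \<Rightarrow>\<^sub>L real) \<Rightarrow> ('a \<Rightarrow> 'a \<Rightarrow>\<^sub>L 'p::real_inner) \<Rightarrow>
    ('a \<Rightarrow> 'a \<Rightarrow>\<^sub>L 'a) \<Rightarrow> 'a \<Rightarrow> 'p \<Rightarrow> 'a \<Rightarrow> 'a" where
  "lag_grad f1 h1 G1 x lam Y =
     (\<Sum>b\<in>Basis. (blinfun_apply (f1 x) b + inner lam (blinfun_apply (h1 x) b)
                   + inner Y (blinfun_apply (G1 x) b)) *\<^sub>R b)"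

definition lag_hess_quad :: "('a::real_inner \<Rightarrow> 'a \<Rightarrow>\<^sub>L 'a \<Rightarrow>\<^sub>L real) \<Rightarrow>
    ('a \<Rightarrow> 'a \<Rightarrow>\<^sub>L 'a \<Rightarrow>\<^sub>L 'p::real_inner) \<Rightarrow> ('a \<Rightarrow> 'a \<Rightarrow>\<^sub>L 'a \<Rightarrow>\<^sub>L 'a) \<Rightarrow>
    'a \<Rightarrow> 'p \<Rightarrow> 'a \<Rightarrow> 'a \<Rightarrow> real" where
  "lag_hess_quad f2 h2 G2 x lam Y Z =
     blinfun_apply (blinfun_apply (f2 x) Z) Z
     + inner lam (blinfun_apply (blinfun_apply (h2 x) Z) Z)
     + inner Y (blinfun_apply (blinfun_apply (G2 x) Z) Z)"

definition multipliers :: "'a::euclidean_space set \<Rightarrow> ('a \<Rightarrow> 'a \<Rightarrow>\<^sub>L real) \<Rightarrow>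
    ('a \<Rightarrow> 'a \<Rightarrow>\<^sub>L 'p::real_inner) \<Rightarrow> ('a \<Rightarrow> 'a \<Rightarrow>\<^sub>L 'a) \<Rightarrow> ('a \<Rightarrow> 'a) \<Rightarrow> 'a \<Rightarrow> ('p \<times> 'a) set" where
  "multipliers K f1 h1 G1 G x = {(lam, Y). lag_grad f1 h1 G1 x lam Y = 0 \<and> Y \<in> normal_cone K (G x)}"

definition critical_cone :: "'a::euclidean_space set \<Rightarrow> ('a \<Rightarrow> 'a \<Rightarrow>\<^sub>L real) \<Rightarrow>
    ('a \<Rightarrow> 'a \<Rightarrow>\<^sub>L 'p::real_inner) \<Rightarrow> ('a \<Rightarrow> 'a \<Rightarrow>\<^sub>L 'a) \<Rightarrow> ('a \<Rightarrow> 'a) \<Rightarrow> 'a \<Rightarrow> 'a set" where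
  "critical_cone K f1 h1 G1 G x = {Z. blinfun_apply (h1 x) Z = 0 \<and>
      blinfun_apply (G1 x) Z \<in> tangent_cone K (G x) \<and> blinfun_apply (f1 x) Z = 0}"

definition Psi_map where
  "Psi_map K f1 h1 G1 h G = (\<lambda>(x, lam, Y).
     (lag_grad f1 h1 G1 x lam Y, h x, G x - closest_point K (G x + Y)))"

definition Psi_tilde_map where
  "Psi_tilde_map K f1 h1 G1 h G = (\<lambda>(df, dh, dG) (x, lam, Y).
     (lag_grad f1 h1 G1 x lam Y - df, h x - dh,
      G x - dG - closest_point K (G x - dG + Y)))"

definition J_map where
  "J_map K f1 h1 G1 h G = (\<lambda>\<delta>. {z. Psi_map K f1 h1 G1 h G z = \<delta>})"

definition J_tilde_map where
  "J_tilde_map K f1 h1 G1 h G = (\<lambda>\<delta>. {z. Psi_tilde_map K f1 h1 G1 h G \<delta> z = 0})"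

definition loc_upper_lipschitz :: "('y::real_normed_vector \<Rightarrow> 'z::real_normed_vector set) \<Rightarrow> 'y \<Rightarrow> 'z \<Rightarrow> bool" where
  "loc_upper_lipschitz S ybar zbar \<longleftrightarrow> zbar \<in> S ybar \<and>
     (\<exists>\<mu>\<ge>0. \<exists>U V. open U \<and> ybar \<in> U \<and> open V \<and> zbar \<in> V \<and> V \<inter> S ybar = {zbar} \<and>
        (\<forall>y\<in>U. S y \<inter> V \<subseteq> cball zbar (\<mu> * norm (y - ybar))))"

end

theory Submission
  imports Defs
begin

text \<open>
  Suppose the Lipschitz estimate fails along perturbed solutions. Normalising their distance to the
  reference point gives in the limit a unit direction \<open>(Z, l, y)\<close> which solves the linearised KKT system,
  where \<open>y\<close> lies in the graphical derivative of the normal cone map at \<open>G' Z\<close>. If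
  \<open>\<langle>y, G' Z\<rangle> \<ge> - \<sigma>(Y, T\<^sup>2)\<close>, the second-order condition forces \<open>Z = 0\<close>, and then the strict Robinson
  condition, which also makes the multiplier unique, forces \<open>l = 0\<close> and \<open>y = 0\<close>.

  The inequality rests on the invariance of the Ky Fan norm under \<open>O(m) \<times> O(n)\<close>. Split a tangent
  direction at \<open>X\<close> into a part \<open>A X - X B\<close> along the orbit and a part \<open>E\<close> orthogonal to the orbit. The
  matrices \<open>X\<close> and \<open>E\<close> have a common system of singular vectors, so that the cone is polyhedral along
  \<open>E\<close>. Rotating the ray through \<open>E\<close> yields a second-order tangent vector \<open>w\<close>. Rotating nearby points of
  the cone back shows that no second-order expansion beats \<open>\<langle>Y, w\<rangle>\<close>, and comparison with the ray scaled by
  \<open>s\<close> gives the inequality as \<open>s\<close> tends to 1 from below.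
\<close>

section \<open>Normal cones of sets regular along orbits\<close>

text \<open>Monotonicity of the normal cone map yields only
  \<open>\<langle>y, d\<rangle> \<ge> 0\<close>. Since the cone is curved, the second-order
  condition does not make the Hessian of the Lagrangian itself positive, and the bound on
  \<open>\<langle>y, d\<rangle>\<close> must contain the same curvature term. No derivative of the
  projection is computed: its equation is rewritten as an inclusion in the normal cone, whose graph
  is followed along sequences. All comparisons are made to order \<open>t\<^sup>2\<close>, so a flow
  known up to a cubic error suffices; this is why quadratic Taylor polynomials stand in for matrix
  exponentials. These polynomials are not orthogonal. Therefore the Ky Fan norm is described through
  families that satisfy a Bessel inequality, which survive multiplication by contractions, rather
  than through orthonormal families. In a singular frame common to \<open>X\<close> and
  \<open>E\<close> the coefficients may have either sign, hence the sign patterns that accompany the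
  choice of \<open>k\<close> indices.\<close>

text \<open>Each tangent direction splits as \<open>d = e + L P\<close>, where \<open>e\<close> spans a feasible ray and the flow of
  \<open>L\<close> preserves \<open>K\<close> to second order. Then \<open>L (L P) + 2 L e\<close> is a second-order tangent vector that
  attains the support function of the second-order tangent set at every critical normal.\<close>

definition orbit_regular :: "'a::real_inner set \<Rightarrow> bool" where
  "orbit_regular K \<longleftrightarrow> (\<forall>P\<in>K. \<forall>d\<in>tangent_cone K P. \<exists>L e C \<epsilon>.
     bounded_linear L \<and> d = e + L P \<and> 0 < \<epsilon> \<and> 0 \<le> C \<and>
     (\<forall>t\<in>{0..\<epsilon>}. P + t *\<^sub>R e \<in> K) \<and>
     (\<forall>Q\<in>K. \<forall>t\<in>{-1..1}. infdist (Q + t *\<^sub>R L Q + (t\<^sup>2 / 2) *\<^sub>R L (L Q)) K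
                             \<le> C * \<bar>t\<bar> ^ 3 * (1 + norm Q)))"

lemma normal_cone_inner_tangent_le_0:
  fixes K :: "'a::real_inner set"
  assumes "Y \<in> normal_cone K P" "d \<in> tangent_cone K P"
  shows "inner Y d \<le> 0"
proof -
  obtain t dd where t: "\<And>j::nat. 0 < t j" and dd: "dd \<longlonglongrightarrow> d" and K: "\<And>j. P + t j *\<^sub>R dd j \<in> K"
    using assms(2) unfolding tangent_cone_def by blast
  have "inner Y (dd j) \<le> 0" for j
  proof -
    have "inner Y (P + t j *\<^sub>R dd j - P) \<le> 0"
      using assms(1) K unfolding normal_cone_def by blast
    then show ?thesis using t[of j] by (simp add: mult_le_0_iff)
  qed
  moreover have "(\<lambda>j. inner Y (dd j)) \<longlonglongrightarrow> inner Y d"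
    by (intro tendsto_intros dd)
  ultimately show ?thesis
    by (meson LIMSEQ_le_const2)
qed

text \<open>Passing to a nearest point of \<open>K\<close> extends the inequality that defines a
  normal to points off \<open>K\<close>. Curves that stay in \<open>K\<close> only up to an error
  can then serve as test points.\<close>

lemma normal_cone_inner_le_infdist:
  fixes K :: "'a::euclidean_space set"
  assumes "closed K" "P \<in> K" "Y \<in> normal_cone K P"
  shows "inner Y (Q - P) \<le> norm Y * infdist Q K"
proof -
  obtain R where R: "R \<in> K" "infdist Q K = dist Q R"
    using infdist_attains_inf[OF assms(1)] assms(2) by blast
  have "inner Y (Q - P) = inner Y (Q - R) + inner Y (R - P)"
    by (simp add: inner_diff_right)
  also have "\<dots> \<le> inner Y (Q - R) + 0"
    using assms(3) R(1) unfolding normal_cone_def by auto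
  also have "\<dots> \<le> norm Y * norm (Q - R)"
    using norm_cauchy_schwarz[of Y "Q - R"] by simp
  finally show ?thesis using R by (simp add: dist_norm)
qed

text \<open>The curve stays near \<open>K\<close> for both signs of \<open>t\<close>, so its
  first-order term can have neither a positive nor a negative product with a normal.\<close>

lemma normal_cone_orthogonal_orbit:
  fixes K :: "'a::euclidean_space set"
  assumes "closed K" "P \<in> K" "Y \<in> normal_cone K P"
    and near: "\<And>t. t \<in> {-1..1} \<Longrightarrow> infdist (P + t *\<^sub>R a + (t\<^sup>2 / 2) *\<^sub>R b) K \<le> C * \<bar>t\<bar> ^ 3"
    and C: "0 \<le> C"
  shows "inner Y a = 0"
proof -
  \<comment> \<open>Coefficient of \<open>t\<^sup>2\<close> once the cubic error is weakened by
    \<open>\<bar>t\<bar> \<le> 1\<close>.\<close>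
  define M where "M = norm Y * C + \<bar>inner Y b\<bar> / 2"
  have *: "t * inner Y a \<le> M * t\<^sup>2" if t: "t \<in> {-1..1}" for t
  proof -
    have "inner Y (P + t *\<^sub>R a + (t\<^sup>2 / 2) *\<^sub>R b - P) \<le> norm Y * (C * \<bar>t\<bar> ^ 3)"
      using normal_cone_inner_le_infdist[OF assms(1-3)] near[OF t]
      by (meson mult_left_mono norm_ge_zero order_trans)
    then have "t * inner Y a + t\<^sup>2 / 2 * inner Y b \<le> norm Y * (C * \<bar>t\<bar> ^ 3)"
      by (simp add: inner_add_right inner_diff_right)
    moreover have "\<bar>t\<bar> ^ 3 \<le> \<bar>t\<bar> ^ 2"
      using t by (intro power_decreasing) auto
    then have "norm Y * (C * \<bar>t\<bar> ^ 3) \<le> norm Y * (C * t\<^sup>2)"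
      using C by (simp add: mult_left_mono)
    moreover have "- (t\<^sup>2 / 2 * inner Y b) \<le> t\<^sup>2 / 2 * \<bar>inner Y b\<bar>"
      using mult_left_mono[of "- inner Y b" "\<bar>inner Y b\<bar>" "t\<^sup>2 / 2"] by simp
    ultimately show ?thesis unfolding M_def by (simp add: algebra_simps)
  qed
  have le: "\<bar>inner Y a\<bar> \<le> M * s" if s: "0 < s" "s \<le> 1" for s
  proof -
    have "s * inner Y a \<le> M * s\<^sup>2" "s * (- inner Y a) \<le> M * s\<^sup>2"
      using *[of s] *[of "-s"] s by auto
    then have "s * \<bar>inner Y a\<bar> \<le> s * (M * s)"
      by (simp add: abs_if power2_eq_square algebra_simps)
    then show ?thesis using s by simp
  qed
  have "((\<lambda>s. M * s) \<longlongrightarrow> M * 0) (at_right 0)"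
    by (intro tendsto_intros)
  moreover have "eventually (\<lambda>s. \<bar>inner Y a\<bar> \<le> M * s) (at_right 0)"
    unfolding eventually_at_right_field by (rule exI[of _ 1]) (auto intro: le)
  ultimately have "\<bar>inner Y a\<bar> \<le> M * 0"
    by (intro tendsto_lowerbound) auto
  then show ?thesis by simp
qed

text \<open>Run the flow for time \<open>t\<close> from the moving point
  \<open>P + t *\<^sub>R e\<close> of \<open>K\<close>. The cross term
  \<open>t\<^sup>2 *\<^sub>R L e\<close> explains the factor 2, which compensates the half in
  \<open>t\<^sup>2 / 2\<close>; what is left over, like the distance to \<open>K\<close>, is cubic
  in \<open>t\<close>.\<close>

lemma second_tangent_set_orbit:
  fixes K :: "'a::euclidean_space set"
  assumes L: "bounded_linear L" and \<epsilon>: "0 < \<epsilon>"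
    and ray: "\<And>t. t \<in> {0..\<epsilon>} \<Longrightarrow> P + t *\<^sub>R e \<in> K"
    and near: "\<And>Q t. Q \<in> K \<Longrightarrow> t \<in> {-1..1} \<Longrightarrow>
        infdist (Q + t *\<^sub>R L Q + (t\<^sup>2 / 2) *\<^sub>R L (L Q)) K \<le> C * \<bar>t\<bar> ^ 3 * (1 + norm Q)"
    and C: "0 \<le> C"
  shows "L (L P) + 2 *\<^sub>R L e \<in> second_tangent_set K P (e + L P)"
proof -
  interpret L: bounded_linear L by (rule L)
  define M where "M = C * (1 + norm P + norm e) + norm (L (L e)) / 2"
  have bd: "infdist (P + t *\<^sub>R (e + L P) + (t\<^sup>2 / 2) *\<^sub>R (L (L P) + 2 *\<^sub>R L e)) K / t\<^sup>2 \<le> M * t"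
    if t: "0 < t" "t < min 1 \<epsilon>" for t
  proof -
    let ?Q = "P + t *\<^sub>R e"
    have Q: "?Q \<in> K" using ray t by auto
    have eq: "?Q + t *\<^sub>R L ?Q + (t\<^sup>2 / 2) *\<^sub>R L (L ?Q)
        = P + t *\<^sub>R (e + L P) + (t\<^sup>2 / 2) *\<^sub>R (L (L P) + 2 *\<^sub>R L e) + (t ^ 3 / 2) *\<^sub>R L (L e)"
      by (simp add: L.add L.scaleR algebra_simps power2_eq_square power3_eq_cube)
    have "infdist (P + t *\<^sub>R (e + L P) + (t\<^sup>2 / 2) *\<^sub>R (L (L P) + 2 *\<^sub>R L e)) K
        \<le> infdist (?Q + t *\<^sub>R L ?Q + (t\<^sup>2 / 2) *\<^sub>R L (L ?Q)) K
          + dist (P + t *\<^sub>R (e + L P) + (t\<^sup>2 / 2) *\<^sub>R (L (L P) + 2 *\<^sub>R L e))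
                 (?Q + t *\<^sub>R L ?Q + (t\<^sup>2 / 2) *\<^sub>R L (L ?Q))"
      by (rule infdist_triangle)
    also have "dist (P + t *\<^sub>R (e + L P) + (t\<^sup>2 / 2) *\<^sub>R (L (L P) + 2 *\<^sub>R L e))
                 (?Q + t *\<^sub>R L ?Q + (t\<^sup>2 / 2) *\<^sub>R L (L ?Q)) = t ^ 3 / 2 * norm (L (L e))"
      unfolding eq dist_norm using t by simp
    also have "infdist (?Q + t *\<^sub>R L ?Q + (t\<^sup>2 / 2) *\<^sub>R L (L ?Q)) K \<le> C * \<bar>t\<bar> ^ 3 * (1 + norm ?Q)"
      using near[OF Q, of t] t by auto
    also have "\<dots> \<le> C * t ^ 3 * (1 + norm P + norm e)"
    proof -
      have "norm ?Q \<le> norm P + t * norm e"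
        using norm_triangle_ineq[of P "t *\<^sub>R e"] t by simp
      also have "\<dots> \<le> norm P + 1 * norm e"
        using t by (intro add_left_mono mult_right_mono) auto
      finally show ?thesis using C t by (auto intro!: mult_left_mono)
    qed
    finally have "infdist (P + t *\<^sub>R (e + L P) + (t\<^sup>2 / 2) *\<^sub>R (L (L P) + 2 *\<^sub>R L e)) K \<le> M * t ^ 3"
      unfolding M_def by (simp add: algebra_simps)
    then have "infdist (P + t *\<^sub>R (e + L P) + (t\<^sup>2 / 2) *\<^sub>R (L (L P) + 2 *\<^sub>R L e)) K \<le> (M * t) * t\<^sup>2"
      by (simp add: power2_eq_square power3_eq_cube algebra_simps)
    then show ?thesis
      using t by (simp add: divide_le_eq)
  qed
  have "((\<lambda>t. M * t) \<longlongrightarrow> M * 0) (at_right 0)"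
    by (intro tendsto_intros)
  then have lim: "((\<lambda>t. M * t) \<longlongrightarrow> 0) (at_right 0)" by simp
  have "((\<lambda>t. infdist (P + t *\<^sub>R (e + L P) + (t\<^sup>2 / 2) *\<^sub>R (L (L P) + 2 *\<^sub>R L e)) K / t\<^sup>2) \<longlongrightarrow> 0) (at_right 0)"
  proof (rule tendsto_sandwich[OF _ _ tendsto_const lim])
    show "eventually (\<lambda>t. infdist (P + t *\<^sub>R (e + L P) + (t\<^sup>2 / 2) *\<^sub>R (L (L P) + 2 *\<^sub>R L e)) K / t\<^sup>2 \<le> M * t) (at_right 0)"
      unfolding eventually_at_right_field
      by (rule exI[of _ "min 1 \<epsilon>"]) (use \<epsilon> bd in auto)
  qed (simp add: infdist_nonneg)
  then show ?thesis unfolding second_tangent_set_def by simp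
qed

text \<open>Moving the points back along the flow of \<open>-L\<close> stays near \<open>K\<close>, where \<open>Y\<close> is nonpositive.\<close>

lemma orbit_second_order_upper_bound:
  fixes K :: "'a::euclidean_space set"
  assumes K: "closed K" "P \<in> K" and Y: "Y \<in> normal_cone K P"
    and L: "bounded_linear L"
    and near: "\<And>Q t. Q \<in> K \<Longrightarrow> t \<in> {-1..1} \<Longrightarrow>
        infdist (Q + t *\<^sub>R L Q + (t\<^sup>2 / 2) *\<^sub>R L (L Q)) K \<le> C * \<bar>t\<bar> ^ 3 * (1 + norm Q)"
    and C: "0 \<le> C"
    and t: "\<And>j::nat. 0 < t j" "t \<longlonglongrightarrow> 0" and d: "dd \<longlonglongrightarrow> e + L P"
    and PK: "\<And>j. P + t j *\<^sub>R dd j \<in> K"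
  obtains r where "r \<longlonglongrightarrow> inner Y (L (L P) + 2 *\<^sub>R L e) / 2"
    "eventually (\<lambda>j. inner Y (dd j) / t j \<le> r j) sequentially"
proof
  interpret L: bounded_linear L by (rule L)
  have orth: "inner Y (L P) = 0"
    using near[OF K(2)] C
    by (intro normal_cone_orthogonal_orbit[OF K Y, of _ "L (L P)" "C * (1 + norm P)"])
       (auto simp: algebra_simps)
  \<comment> \<open>What remains when the point moved back is expanded, paired with \<open>Y\<close>
    and divided by \<open>(t j)\<^sup>2\<close>; \<open>orth\<close> has removed the contribution of
    \<open>L P\<close>. In the limit, \<open>inner Y (L (e + L P)) - inner Y (L (L P)) / 2\<close>
    is half the product with \<open>L (L P) + 2 *\<^sub>R L e\<close>.\<close>
  define r where "r j = inner Y (L (dd j)) - inner Y (L (L P)) / 2 - t j * inner Y (L (L (dd j))) / 2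
      + norm Y * (C * t j * (1 + norm (P + t j *\<^sub>R dd j)))" for j
  have Ld: "(\<lambda>j. L (dd j)) \<longlonglongrightarrow> L (e + L P)" "(\<lambda>j. L (L (dd j))) \<longlonglongrightarrow> L (L (e + L P))"
    by (intro L.tendsto d)+
  have "r \<longlonglongrightarrow> inner Y (L (e + L P)) - inner Y (L (L P)) / 2 - 0 * inner Y (L (L (e + L P))) / 2
      + norm Y * (C * 0 * (1 + norm (P + 0 *\<^sub>R (e + L P))))"
    unfolding r_def by (intro tendsto_intros Ld t d) auto
  then show "r \<longlonglongrightarrow> inner Y (L (L P) + 2 *\<^sub>R L e) / 2"
    by (simp add: L.add inner_add_right field_simps)
  have "eventually (\<lambda>j. t j < 1) sequentially"
    using order_tendstoD(2)[OF t(2)] by simp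
  then show "eventually (\<lambda>j. inner Y (dd j) / t j \<le> r j) sequentially"
  proof eventually_elim
    case (elim j)
    let ?t = "t j"
    let ?Q = "P + ?t *\<^sub>R dd j"
    have tj: "0 < ?t" "?t < 1" using t elim by auto
    have "inner Y (?Q + (-?t) *\<^sub>R L ?Q + ((-?t)\<^sup>2 / 2) *\<^sub>R L (L ?Q) - P)
        \<le> norm Y * (C * \<bar>-?t\<bar> ^ 3 * (1 + norm ?Q))"
      using normal_cone_inner_le_infdist[OF K Y] near[OF PK[of j], of "-?t"] tj
      by (meson mult_left_mono norm_ge_zero order_trans atLeastAtMost_iff neg_le_iff_le less_imp_le
            neg_le_0_iff_le zero_le_one order.trans)
    then have "?t * inner Y (dd j) - ?t\<^sup>2 * inner Y (L (dd j)) + ?t\<^sup>2 / 2 * inner Y (L (L P))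
         + ?t ^ 3 / 2 * inner Y (L (L (dd j))) \<le> norm Y * (C * ?t ^ 3 * (1 + norm ?Q))"
      using tj orth
      by (simp add: L.add L.scaleR L.diff inner_add_right inner_diff_right algebra_simps
          power2_eq_square power3_eq_cube)
    then have "?t * inner Y (dd j) \<le> ?t * (r j * ?t)"
      unfolding r_def by (simp add: algebra_simps power2_eq_square power3_eq_cube)
    then show ?case using tj by (simp add: divide_le_eq)
  qed
qed

text \<open>The perturbed normal is tested on the curve with velocity \<open>s *\<^sub>R d'\<close>
  and acceleration \<open>s\<^sup>2 *\<^sub>R w\<close>, which is within \<open>o(t\<^sup>2)\<close>
  of \<open>K\<close>. Division by \<open>t\<^sup>2\<close> gives a lower bound for
  \<open>inner Y (dd j) / t j\<close>, to be compared with the upper bound \<open>r\<close>. The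
  speed \<open>s\<close> is left free because the applications let it tend to different
  limits.\<close>

lemma normal_cone_recovery_inequality:
  fixes K :: "'a::euclidean_space set"
  assumes K: "closed K"
    and t: "\<And>j::nat. 0 < t j" "t \<longlonglongrightarrow> 0" and d: "dd \<longlonglongrightarrow> d" and y: "yy \<longlonglongrightarrow> y"
    and PK: "\<And>j. P + t j *\<^sub>R dd j \<in> K"
    and N: "\<And>j. Y + t j *\<^sub>R yy j \<in> normal_cone K (P + t j *\<^sub>R dd j)"
    and w: "w \<in> second_tangent_set K P d'" "inner Y d' = 0" and s: "0 < s"
    and r: "r \<longlonglongrightarrow> \<rho>" "eventually (\<lambda>j. inner Y (dd j) / t j \<le> r j) sequentially"
  shows "s\<^sup>2 / 2 * inner Y w + inner y (s *\<^sub>R d' - d) \<le> \<rho>"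
proof -
  define \<iota> where "\<iota> x = infdist (P + x *\<^sub>R d' + (x\<^sup>2 / 2) *\<^sub>R w) K / x\<^sup>2" for x
  have "filterlim (\<lambda>j. s * t j) (at_right 0) sequentially"
  proof (rule tendsto_imp_filterlim_at_right)
    show "(\<lambda>j. s * t j) \<longlonglongrightarrow> 0" using tendsto_mult_left[OF t(2), of s] by simp
  qed (use s t in simp)
  moreover have "(\<iota> \<longlongrightarrow> 0) (at_right 0)"
    using w(1) unfolding second_tangent_set_def \<iota>_def by simp
  ultimately have i: "(\<lambda>j. \<iota> (s * t j)) \<longlonglongrightarrow> 0"
    by (rule filterlim_compose[rotated])
  define l where "l j = s\<^sup>2 / 2 * inner Y w + inner (yy j) (s *\<^sub>R d' + (s\<^sup>2 / 2 * t j) *\<^sub>R w - dd j)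
      - norm (Y + t j *\<^sub>R yy j) * (s\<^sup>2 * \<iota> (s * t j))" for j
  have le: "l j \<le> inner Y (dd j) / t j" for j
  proof -
    let ?t = "t j"
    let ?Q = "P + (s * ?t) *\<^sub>R d' + ((s * ?t)\<^sup>2 / 2) *\<^sub>R w"
    have tj: "0 < ?t" by (rule t)
    have "inner (Y + ?t *\<^sub>R yy j) (?Q - (P + ?t *\<^sub>R dd j)) \<le> norm (Y + ?t *\<^sub>R yy j) * infdist ?Q K"
      by (rule normal_cone_inner_le_infdist[OF K PK N])
    also have "infdist ?Q K = (s * ?t)\<^sup>2 * \<iota> (s * ?t)"
      unfolding \<iota>_def using s tj by simp
    finally have "?t\<^sup>2 * l j \<le> ?t * inner Y (dd j)"
      unfolding l_def using w(2)
      by (simp add: inner_add_left inner_add_right inner_diff_right algebra_simps power2_eq_square add_divide_distrib)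
    then have "?t * (l j * ?t) \<le> ?t * inner Y (dd j)"
      by (simp add: power2_eq_square algebra_simps)
    then show ?thesis using tj by (simp add: le_divide_eq)
  qed
  have "l \<longlonglongrightarrow> s\<^sup>2 / 2 * inner Y w + inner y (s *\<^sub>R d' + (s\<^sup>2 / 2 * 0) *\<^sub>R w - d)
      - norm (Y + 0 *\<^sub>R y) * (s\<^sup>2 * 0)"
    unfolding l_def by (intro tendsto_intros t d y i)
  then have "l \<longlonglongrightarrow> s\<^sup>2 / 2 * inner Y w + inner y (s *\<^sub>R d' - d)" by simp
  moreover have "eventually (\<lambda>j. l j \<le> r j) sequentially"
    using r(2) by eventually_elim (use le order_trans in blast)
  ultimately show ?thesis
    using r(1) by (intro tendsto_le[of sequentially r \<rho> l]) auto
qed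

text \<open>In the next three lemmas the sequences express that \<open>y\<close> belongs to the graphical derivative of
  the normal cone map at \<open>P\<close> for \<open>Y\<close>, evaluated at \<open>d\<close>.\<close>

lemma normal_cone_limit_inner_zero:
  fixes K :: "'a::euclidean_space set"
  assumes P: "P \<in> K" and Y: "Y \<in> normal_cone K P"
    and t: "\<And>j::nat. 0 < t j" "t \<longlonglongrightarrow> 0" and d: "dd \<longlonglongrightarrow> d" and y: "yy \<longlonglongrightarrow> y"
    and PK: "\<And>j. P + t j *\<^sub>R dd j \<in> K"
    and N: "\<And>j. Y + t j *\<^sub>R yy j \<in> normal_cone K (P + t j *\<^sub>R dd j)"
  shows "inner Y d = 0"
proof (rule antisym)
  have "d \<in> tangent_cone K P"
    unfolding tangent_cone_def using t d PK by blast
  then show "inner Y d \<le> 0" by (rule normal_cone_inner_tangent_le_0[OF Y])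
  \<comment> \<open>The perturbed normal, tested at the base point \<open>P\<close>, supplies the
    opposite sign.\<close>
  have "0 \<le> inner (Y + t j *\<^sub>R yy j) (dd j)" for j
  proof -
    have "inner (Y + t j *\<^sub>R yy j) (P - (P + t j *\<^sub>R dd j)) \<le> 0"
      using N[of j] P unfolding normal_cone_def by blast
    then have "0 \<le> t j * inner (Y + t j *\<^sub>R yy j) (dd j)" by simp
    then show ?thesis using t(1)[of j] by (simp add: zero_le_mult_iff)
  qed
  moreover have "(\<lambda>j. inner (Y + t j *\<^sub>R yy j) (dd j)) \<longlonglongrightarrow> inner (Y + 0 *\<^sub>R y) d"
    by (intro tendsto_intros t d y)
  ultimately have "0 \<le> inner (Y + 0 *\<^sub>R y) d"
    by (meson LIMSEQ_le_const)
  then show "0 \<le> inner Y d" by simp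
qed

lemma orbit_regular_graphical_derivative:
  fixes K :: "'a::euclidean_space set"
  assumes K: "closed K" "orbit_regular K" and P: "P \<in> K" and Y: "Y \<in> normal_cone K P"
    and t: "\<And>j::nat. 0 < t j" "t \<longlonglongrightarrow> 0" and d: "dd \<longlonglongrightarrow> d" and y: "yy \<longlonglongrightarrow> y"
    and PK: "\<And>j. P + t j *\<^sub>R dd j \<in> K"
    and N: "\<And>j. Y + t j *\<^sub>R yy j \<in> normal_cone K (P + t j *\<^sub>R dd j)"
  obtains w where "w \<in> second_tangent_set K P d" "- inner Y w \<le> inner y d"
proof -
  have dT: "d \<in> tangent_cone K P"
    unfolding tangent_cone_def using t d PK by blast
  have Yd: "inner Y d = 0"
    by (rule normal_cone_limit_inner_zero[OF P Y t d y PK N])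
  obtain L e C \<epsilon> where L: "bounded_linear L" and de: "d = e + L P" and \<epsilon>: "0 < \<epsilon>" and C: "0 \<le> C"
    and ray: "\<And>t. t \<in> {0..\<epsilon>} \<Longrightarrow> P + t *\<^sub>R e \<in> K"
    and near: "\<And>Q t. Q \<in> K \<Longrightarrow> t \<in> {-1..1} \<Longrightarrow>
        infdist (Q + t *\<^sub>R L Q + (t\<^sup>2 / 2) *\<^sub>R L (L Q)) K \<le> C * \<bar>t\<bar> ^ 3 * (1 + norm Q)"
    using K(2)[unfolded orbit_regular_def, rule_format, OF P dT] by blast
  define w where "w = L (L P) + 2 *\<^sub>R L e"
  have w: "w \<in> second_tangent_set K P d"
    unfolding w_def de by (rule second_tangent_set_orbit[OF L \<epsilon> ray near C])
  obtain r where r: "r \<longlonglongrightarrow> inner Y w / 2"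
    "eventually (\<lambda>j. inner Y (dd j) / t j \<le> r j) sequentially"
    using orbit_second_order_upper_bound[OF K(1) P Y L near C t d[unfolded de] PK]
    unfolding w_def by blast
  \<comment> \<open>At \<open>s = 1\<close> the recovery inequality is trivial. For
    \<open>s < 1\<close> the factor \<open>1 - s\<close> of \<open>1 - s\<^sup>2\<close> is positive
    and cancels before the limit is taken; for \<open>s > 1\<close> the inequality would point the
    other way.\<close>
  have ineq: "- ((1 + s) / 2) * inner Y w \<le> inner y d" if s: "0 < s" "s < 1" for s
  proof -
    have "s\<^sup>2 / 2 * inner Y w + inner y (s *\<^sub>R d - d) \<le> inner Y w / 2"
      by (rule normal_cone_recovery_inequality[OF K(1) t d y PK N w Yd s(1) r])
    then have "(1 - s) * (- ((1 + s) / 2) * inner Y w) \<le> (1 - s) * inner y d"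
      by (simp add: inner_diff_right algebra_simps power2_eq_square diff_divide_distrib add_divide_distrib)
    then show ?thesis by (rule mult_left_le_imp_le) (use s in simp)
  qed
  have "((\<lambda>s. - ((1 + s) / 2) * inner Y w) \<longlongrightarrow> - ((1 + 1) / 2) * inner Y w) (at_left (1::real))"
    by (intro tendsto_intros) auto
  moreover have "eventually (\<lambda>s. - ((1 + s) / 2) * inner Y w \<le> inner y d) (at_left (1::real))"
    unfolding eventually_at_left_field by (rule exI[of _ 0]) (use ineq in auto)
  ultimately have "- ((1 + 1) / 2) * inner Y w \<le> inner y d"
    by (intro tendsto_upperbound) auto
  then show ?thesis using that[OF w] by simp
qed

lemma orbit_regular_graphical_derivative_at_0:
  fixes K :: "'a::euclidean_space set"
  assumes K: "closed K" "orbit_regular K" and P: "P \<in> K" and Y: "Y \<in> normal_cone K P"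
    and t: "\<And>j::nat. 0 < t j" "t \<longlonglongrightarrow> 0" and d: "dd \<longlonglongrightarrow> 0" and y: "yy \<longlonglongrightarrow> y"
    and PK: "\<And>j. P + t j *\<^sub>R dd j \<in> K"
    and N: "\<And>j. Y + t j *\<^sub>R yy j \<in> normal_cone K (P + t j *\<^sub>R dd j)"
    and W: "W \<in> tangent_cone K P" "inner Y W = 0"
  shows "inner y W \<le> 0"
proof -
  obtain L e C \<epsilon> where L: "bounded_linear L" and de: "W = e + L P" and \<epsilon>: "0 < \<epsilon>" and C: "0 \<le> C"
    and ray: "\<And>t. t \<in> {0..\<epsilon>} \<Longrightarrow> P + t *\<^sub>R e \<in> K"
    and near: "\<And>Q t. Q \<in> K \<Longrightarrow> t \<in> {-1..1} \<Longrightarrow>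
        infdist (Q + t *\<^sub>R L Q + (t\<^sup>2 / 2) *\<^sub>R L (L Q)) K \<le> C * \<bar>t\<bar> ^ 3 * (1 + norm Q)"
    using K(2)[unfolded orbit_regular_def, rule_format, OF P W(1)] by blast
  define w where "w = L (L P) + 2 *\<^sub>R L e"
  have w: "w \<in> second_tangent_set K P W"
    unfolding w_def de by (rule second_tangent_set_orbit[OF L \<epsilon> ray near C])
  have neg: "inner Y (dd j) / t j \<le> 0" for j
  proof -
    have "inner Y (P + t j *\<^sub>R dd j - P) \<le> 0"
      using Y PK unfolding normal_cone_def by blast
    then show ?thesis using t(1)[of j] by (simp add: mult_le_0_iff divide_le_0_iff)
  qed
  \<comment> \<open>With limit direction 0 the upper bound is the constant 0 from
    \<open>neg\<close>. The curvature term carries \<open>s\<^sup>2\<close> but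
    \<open>inner y W\<close> only \<open>s\<close>, so slow test curves isolate the latter.\<close>
  have ineq: "s / 2 * inner Y w + inner y W \<le> 0" if s: "0 < s" for s
  proof -
    have "s\<^sup>2 / 2 * inner Y w + inner y (s *\<^sub>R W - 0) \<le> 0"
      by (rule normal_cone_recovery_inequality[OF K(1) t d y PK N w W(2) s tendsto_const])
         (use neg in simp)
    then have "s * (s / 2 * inner Y w + inner y W) \<le> s * 0"
      by (simp add: algebra_simps power2_eq_square)
    then show ?thesis using s by (simp only: mult_le_cancel_left_pos)
  qed
  have "((\<lambda>s. s / 2 * inner Y w + inner y W) \<longlongrightarrow> 0 / 2 * inner Y w + inner y W) (at_right (0::real))"
    by (intro tendsto_intros) auto
  moreover have "eventually (\<lambda>s. s / 2 * inner Y w + inner y W \<le> 0) (at_right (0::real))"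
    unfolding eventually_at_right_field by (rule exI[of _ 1]) (use ineq in auto)
  ultimately have "0 / 2 * inner Y w + inner y W \<le> 0"
    by (intro tendsto_upperbound) auto
  then show ?thesis by simp
qed

section \<open>Simultaneous singular value decomposition\<close>

text \<open>Maximise the Rayleigh quotient over the unit sphere of \<open>S\<close>. The form
  \<open>\<mu> * inner y y - inner y (F y)\<close> is nonnegative on \<open>S\<close> and vanishes
  at the maximiser; a nonnegative quadratic form vanishes only on its kernel, which here is the
  eigenspace.\<close>

lemma selfadjoint_top_eigenvector:
  fixes F :: "'a::euclidean_space \<Rightarrow> 'a"
  assumes F: "linear F" "\<And>x y. inner (F x) y = inner x (F y)"
    and S: "subspace S" "F ` S \<subseteq> S" "\<exists>x\<in>S. x \<noteq> 0"
  obtains x \<mu> where "x \<in> S" "norm x = 1" "F x = \<mu> *\<^sub>R x"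
    "\<And>y. y \<in> S \<Longrightarrow> inner y (F y) \<le> \<mu> * inner y y"
proof -
  let ?B = "S \<inter> sphere 0 1"
  interpret F: linear F by (rule F)
  obtain x0 where x0: "x0 \<in> S" "x0 \<noteq> 0" using S by blast
  have scl: "c *\<^sub>R y \<in> S" if "y \<in> S" for c y
    using S(1) that by (rule subspace_scale)
  have "(1 / norm x0) *\<^sub>R x0 \<in> ?B" using x0 scl by auto
  then have ne: "?B \<noteq> {}" by blast
  have comp: "compact ?B"
    using closed_subspace[OF S(1)] by (metis closed_Int_compact compact_sphere)
  have cont: "continuous_on ?B (\<lambda>x. inner x (F x))"
    by (intro continuous_intros linear_continuous_on linear_conv_bounded_linear[THEN iffD1] F(1))
  obtain x where x: "x \<in> ?B" and max: "\<And>y. y \<in> ?B \<Longrightarrow> inner y (F y) \<le> inner x (F x)"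
    using continuous_attains_sup[OF comp ne cont] by blast
  define \<mu> where "\<mu> = inner x (F x)"
  have le: "inner y (F y) \<le> \<mu> * inner y y" if y: "y \<in> S" for y
  proof (cases "y = 0")
    case True then show ?thesis by (simp add: F.zero)
  next
    case False
    have "(1 / norm y) *\<^sub>R y \<in> ?B" using False y scl by auto
    from max[OF this] have "inner y (F y) / (norm y)\<^sup>2 \<le> \<mu>"
      by (simp add: F.scaleR \<mu>_def power2_eq_square)
    then show ?thesis using False by (simp add: divide_le_eq power2_norm_eq_inner)
  qed
  define z where "z = \<mu> *\<^sub>R x - F x"
  have xS: "x \<in> S" "norm x = 1" "inner x x = 1" using x by (auto simp: norm_eq_1)
  have zS: "z \<in> S"
    unfolding z_def using xS S scl subspace_diff by blast
  have q: "0 \<le> 2 * s * inner z z + s\<^sup>2 * (\<mu> * inner z z - inner z (F z))" for s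
  proof -
    have "x + s *\<^sub>R z \<in> S" using xS zS scl S(1) subspace_add by blast
    from le[OF this] have "0 \<le> \<mu> * inner (x + s *\<^sub>R z) (x + s *\<^sub>R z) - inner (x + s *\<^sub>R z) (F (x + s *\<^sub>R z))"
      by simp
    also have "\<dots> = (\<mu> * inner x x - inner x (F x)) + 2 * s * (\<mu> * inner x z - inner (F x) z)
        + s\<^sup>2 * (\<mu> * inner z z - inner z (F z))"
      using F(2)[of x z]
      by (simp add: F.add F.scaleR inner_add_left inner_add_right inner_commute algebra_simps power2_eq_square)
    also have "\<mu> * inner x z - inner (F x) z = inner z z"
      by (subst (2) z_def) (simp add: inner_diff_left inner_diff_right)
    finally show ?thesis by (simp add: xS \<mu>_def)
  qed
  have "inner z z = 0"
  proof (rule ccontr)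
    assume nz: "inner z z \<noteq> 0"
    then have pos: "0 < inner z z" by (simp add: inner_gt_zero_iff)
    define b where "b = \<mu> * inner z z - inner z (F z)"
    have b: "0 \<le> b" using le[OF zS] by (simp add: b_def)
    \<comment> \<open>Small enough for \<open>s * b \<le> inner z z\<close>, so that the form would
      be negative at \<open>x - s *\<^sub>R z\<close>; the added 1 covers
      \<open>b = 0\<close>.\<close>
    define s where "s = inner z z / (b + 1)"
    have s: "0 < s" using b pos by (simp add: s_def)
    have "s * (2 * inner z z) \<le> s * (s * b)"
      using q[of "- s"] by (simp add: b_def power2_eq_square algebra_simps)
    then have "2 * inner z z \<le> s * b"
      by (rule mult_left_le_imp_le) (rule s)
    also have "s * b \<le> inner z z"
      using b pos unfolding s_def by (simp add: field_simps)
    finally show False using pos by simp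
  qed
  then have "F x = \<mu> *\<^sub>R x" by (simp add: z_def)
  then show ?thesis using that xS le by blast
qed

lemma ex_nonzero_orthogonal_family:
  fixes u :: "nat \<Rightarrow> 'a::euclidean_space"
  assumes "r < DIM('a)"
  shows "\<exists>x. x \<noteq> 0 \<and> (\<forall>i<r. inner x (u i) = 0)"
proof -
  have "dim (u ` {..<r}) \<le> card (u ` {..<r})"
    by (intro dim_le_card') auto
  also have "\<dots> \<le> r" using card_image_le[of "{..<r}" u] by simp
  finally have "dim (u ` {..<r}) < DIM('a)" using assms by simp
  then obtain x where "x \<noteq> 0" "\<And>y. y \<in> span (u ` {..<r}) \<Longrightarrow> orthogonal x y"
    using orthogonal_to_subspace_exists by blast
  then show ?thesis
    by (intro exI[of _ x]) (auto simp: orthogonal_def span_base)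
qed

text \<open>The hypotheses say that the symmetric dilations of \<open>X\<close> and \<open>E\<close> commute, so the top eigenspace
  of one is invariant under the other; a nonzero eigenvalue forces both components of an
  eigenvector to have the same norm.\<close>

lemma common_singular_pair:
  fixes X E :: "real^'n^'m"
  assumes c1: "\<And>a. X *v (a v* E) = E *v (a v* X)"
    and c2: "\<And>b. (E *v b) v* X = (X *v b) v* E"
    and U: "subspace U" and V: "subspace V"
    and iX: "\<And>b. b \<in> V \<Longrightarrow> X *v b \<in> U" "\<And>a. a \<in> U \<Longrightarrow> a v* X \<in> V"
    and iE: "\<And>b. b \<in> V \<Longrightarrow> E *v b \<in> U" "\<And>a. a \<in> U \<Longrightarrow> a v* E \<in> V"
    and nz: "\<exists>b\<in>V. X *v b \<noteq> 0"
  shows "\<exists>a\<in>U. \<exists>b\<in>V. \<exists>x e. norm a = 1 \<and> norm b = 1 \<and> X *v b = x *\<^sub>R a \<and> a v* X = x *\<^sub>R b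
     \<and> E *v b = e *\<^sub>R a \<and> a v* E = e *\<^sub>R b"
proof -
  define F where "F = (\<lambda>(a, b). (X *v b, a v* X))"
  define H where "H = (\<lambda>(a, b). (E *v b, a v* E))"
  have adj: "inner (Y *v b) a = inner b (a v* Y)" for Y :: "real^'n^'m" and a b
    by (metis dot_lmul_matrix inner_commute)
  have lin: "linear F" "linear H"
    unfolding F_def H_def
    by (auto intro!: linearI simp: matrix_vector_right_distrib matrix_vector_mult_scaleR
         vector_matrix_left_distrib scaleR_vector_matrix_assoc split: prod.splits)
  have sa: "inner (F p) q = inner p (F q)" "inner (H p) q = inner p (H q)" for p q
    unfolding F_def H_def
    by (auto simp: adj[symmetric] dot_lmul_matrix split: prod.splits)
  have com: "F (H p) = H (F p)" for p
    unfolding F_def H_def using c1 c2 by (auto split: prod.splits)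
  define S where "S = U \<times> V"
  have S: "subspace S" unfolding S_def using U V by (rule subspace_Times)
  have SF: "F ` S \<subseteq> S" "H ` S \<subseteq> S" unfolding S_def F_def H_def using iX iE by auto
  obtain b0 where b0: "b0 \<in> V" "X *v b0 \<noteq> 0" using nz by blast
  then have Snz: "\<exists>x\<in>S. x \<noteq> 0"
    unfolding S_def using iX by (intro bexI[of _ "(X *v b0, b0)"]) (auto simp: prod_eq_iff zero_prod_def)
  obtain p \<mu> where p: "p \<in> S" "norm p = 1" "F p = \<mu> *\<^sub>R p"
    and top: "\<And>y. y \<in> S \<Longrightarrow> inner y (F y) \<le> \<mu> * inner y y"
    using selfadjoint_top_eigenvector[OF lin(1) sa(1) S SF(1) Snz] by blast
  \<comment> \<open>A pair whose components are matched by \<open>X\<close> has a positive Rayleigh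
    quotient, and the top eigenvalue is at least that large.\<close>
  have "0 < \<mu>"
  proof -
    let ?y = "(X *v b0, b0)"
    have "inner ?y (F ?y) = 2 * inner (X *v b0) (X *v b0)"
      by (simp add: F_def adj[symmetric] inner_commute)
    also have "\<dots> > 0" using b0 by (simp add: inner_gt_zero_iff)
    finally have "0 < \<mu> * inner ?y ?y"
      using top[of ?y] b0 iX unfolding S_def by auto
    then show ?thesis by (rule zero_less_mult_pos2) (use b0 in \<open>simp add: add_pos_nonneg\<close>)
  qed
  interpret F: linear F by (rule lin)
  interpret H: linear H by (rule lin)
  define S' where "S' = {q \<in> S. F q = \<mu> *\<^sub>R q}"
  have S': "subspace S'"
    unfolding S'_def using S
    by (auto simp: subspace_def F.zero F.add F.scaleR scaleR_add_right)
  have HS': "H ` S' \<subseteq> S'"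
  proof (rule image_subsetI)
    fix q assume "q \<in> S'"
    then show "H q \<in> S'"
      using SF(2) com[of q] H.scaleR[of \<mu> q] by (simp add: S'_def image_subset_iff)
  qed
  have "p \<in> S'" "p \<noteq> 0" using p unfolding S'_def by auto
  then have S'nz: "\<exists>x\<in>S'. x \<noteq> 0" by blast
  obtain q e where q: "q \<in> S'" "norm q = 1" "H q = e *\<^sub>R q"
    using selfadjoint_top_eigenvector[OF lin(2) sa(2) S' HS' S'nz] by blast
  obtain a b where ab: "q = (a, b)" by (cases q)
  have eqs: "a \<in> U" "b \<in> V" "X *v b = \<mu> *\<^sub>R a" "a v* X = \<mu> *\<^sub>R b"
    "E *v b = e *\<^sub>R a" "a v* E = e *\<^sub>R b"
    using q unfolding ab S'_def S_def F_def H_def by auto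
  have "\<mu> * inner a a = \<mu> * inner b b"
    using adj[of X b a] eqs by simp
  then have nab: "norm a = norm b" using \<open>0 < \<mu>\<close> by (simp add: norm_eq_sqrt_inner)
  have "a \<noteq> 0" using nab q(2) unfolding ab by (auto simp: norm_Pair)
  define c where "c = 1 / norm a"
  have "c *\<^sub>R a \<in> U" "c *\<^sub>R b \<in> V"
    using eqs(1,2) U V by (auto simp: subspace_scale)
  moreover have "norm (c *\<^sub>R a) = 1" "norm (c *\<^sub>R b) = 1"
    using \<open>a \<noteq> 0\<close> nab by (auto simp: c_def)
  moreover have "X *v (c *\<^sub>R b) = \<mu> *\<^sub>R (c *\<^sub>R a)" "(c *\<^sub>R a) v* X = \<mu> *\<^sub>R (c *\<^sub>R b)"
    "E *v (c *\<^sub>R b) = e *\<^sub>R (c *\<^sub>R a)" "(c *\<^sub>R a) v* E = e *\<^sub>R (c *\<^sub>R b)"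
    using eqs(3-6) by (simp_all add: matrix_vector_mult_scaleR scaleR_vector_matrix_assoc)
  ultimately show ?thesis by blast
qed

text \<open>Deflation: \<open>X\<close>, \<open>E\<close> and their transposes exchange the
  orthogonal complements \<open>U\<close> and \<open>V\<close> of the vectors found so far, so a
  further common pair is sought there. If \<open>X\<close> vanishes on \<open>V\<close>, the roles
  of \<open>X\<close> and \<open>E\<close> are swapped; if both vanish, any unit vectors serve with
  value 0. A nonzero vector of \<open>V\<close> remains because
  \<open>r < CARD('m) \<le> CARD('n)\<close>.\<close>

lemma simultaneous_singular_vectors:
  fixes X E :: "real^'n^'m"
  assumes mn: "CARD('m) \<le> CARD('n)"
    and c1: "\<And>a. X *v (a v* E) = E *v (a v* X)"
    and c2: "\<And>b. (E *v b) v* X = (X *v b) v* E"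
    and r: "r \<le> CARD('m)"
  shows "\<exists>(u :: nat \<Rightarrow> real^'m) (v :: nat \<Rightarrow> real^'n) x e.
    (\<forall>i<r. \<forall>j<r. inner (u i) (u j) = (if i = j then 1 else 0)) \<and>
    (\<forall>i<r. \<forall>j<r. inner (v i) (v j) = (if i = j then 1 else 0)) \<and>
    (\<forall>i<r. X *v v i = x i *\<^sub>R u i \<and> u i v* X = x i *\<^sub>R v i \<and>
           E *v v i = e i *\<^sub>R u i \<and> u i v* E = e i *\<^sub>R v i)"
  using r
proof (induction r)
  case 0
  show ?case by simp
next
  case (Suc r)
  obtain u :: "nat \<Rightarrow> real^'m" and v :: "nat \<Rightarrow> real^'n" and x e where
    IH: "\<forall>i<r. \<forall>j<r. inner (u i) (u j) = (if i = j then 1 else 0)"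
      "\<forall>i<r. \<forall>j<r. inner (v i) (v j) = (if i = j then 1 else 0)"
      "\<forall>i<r. X *v v i = x i *\<^sub>R u i \<and> u i v* X = x i *\<^sub>R v i \<and>
           E *v v i = e i *\<^sub>R u i \<and> u i v* E = e i *\<^sub>R v i"
    using Suc.IH[OF Suc_leD[OF Suc.prems]] by (elim exE conjE)
  have ou: "inner (u i) (u j) = (if i = j then 1 else 0)" if "i < r" "j < r" for i j
    using IH(1) that by blast
  have ov: "inner (v i) (v j) = (if i = j then 1 else 0)" if "i < r" "j < r" for i j
    using IH(2) that by blast
  have sv: "X *v v i = x i *\<^sub>R u i" "u i v* X = x i *\<^sub>R v i"
      "E *v v i = e i *\<^sub>R u i" "u i v* E = e i *\<^sub>R v i" if "i < r" for i
    using IH(3) that by blast+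
  have adj: "inner (Y *v b) a = inner b (a v* Y)" for Y :: "real^'n^'m" and a b
    by (metis dot_lmul_matrix inner_commute)
  have adj': "inner (a v* Y) b = inner a (Y *v b)" for Y :: "real^'n^'m" and a b
    using adj[of Y b a] by (simp add: inner_commute)
  define U where "U = {a. \<forall>i<r. inner a (u i) = 0}"
  define V where "V = {b. \<forall>i<r. inner b (v i) = 0}"
  have sub: "subspace U" "subspace V"
    unfolding U_def V_def by (auto simp: subspace_def inner_add_left)
  have inv: "\<And>b. b \<in> V \<Longrightarrow> X *v b \<in> U" "\<And>a. a \<in> U \<Longrightarrow> a v* X \<in> V"
    "\<And>b. b \<in> V \<Longrightarrow> E *v b \<in> U" "\<And>a. a \<in> U \<Longrightarrow> a v* E \<in> V"
    unfolding U_def V_def by (auto simp: adj dot_lmul_matrix sv)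
  have "\<exists>a\<in>U. \<exists>b\<in>V. \<exists>x e. norm a = 1 \<and> norm b = 1 \<and> X *v b = x *\<^sub>R a \<and> a v* X = x *\<^sub>R b
     \<and> E *v b = e *\<^sub>R a \<and> a v* E = e *\<^sub>R b"
  proof (cases "\<exists>b\<in>V. X *v b \<noteq> 0")
    case True
    show ?thesis by (rule common_singular_pair[OF c1 c2 sub inv True])
  next
    case X0: False
    show ?thesis
    proof (cases "\<exists>b\<in>V. E *v b \<noteq> 0")
      case True
      have "\<exists>a\<in>U. \<exists>b\<in>V. \<exists>e x. norm a = 1 \<and> norm b = 1 \<and> E *v b = e *\<^sub>R a \<and> a v* E = e *\<^sub>R b
         \<and> X *v b = x *\<^sub>R a \<and> a v* X = x *\<^sub>R b"
        by (rule common_singular_pair[OF c1[symmetric] c2[symmetric] sub inv(3,4,1,2) True])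
      then show ?thesis by meson
    next
      case E0: False
      have van: "a v* Y = 0"
        if "\<not> (\<exists>b\<in>V. Y *v b \<noteq> 0)" "a v* Y \<in> V" for Y :: "real^'n^'m" and a
      proof -
        have "inner (a v* Y) (a v* Y) = inner a (Y *v (a v* Y))"
          by (rule adj')
        then show ?thesis using that by simp
      qed
      obtain a where a: "a \<noteq> 0" "a \<in> U"
        using ex_nonzero_orthogonal_family[of r u] Suc.prems unfolding U_def by auto
      obtain b where b: "b \<noteq> 0" "b \<in> V"
        using ex_nonzero_orthogonal_family[of r v] Suc.prems mn unfolding V_def by auto
      have ab: "(1 / norm a) *\<^sub>R a \<in> U" "(1 / norm b) *\<^sub>R b \<in> V"
        using a b sub by (auto simp: subspace_scale)
      have z: "X *v ((1 / norm b) *\<^sub>R b) = 0" "E *v ((1 / norm b) *\<^sub>R b) = 0"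
        using X0 E0 ab by blast+
      have z': "((1 / norm a) *\<^sub>R a) v* X = 0" "((1 / norm a) *\<^sub>R a) v* E = 0"
        using van[OF X0 inv(2)[OF ab(1)]] van[OF E0 inv(4)[OF ab(1)]] by auto
      show ?thesis
        using a b z z'
        by (intro bexI[OF _ ab(1)] bexI[OF _ ab(2)] exI[of _ 0]) auto
    qed
  qed
  then obtain a b x' e' where new: "a \<in> U" "b \<in> V" "norm a = 1" "norm b = 1"
    "X *v b = x' *\<^sub>R a" "a v* X = x' *\<^sub>R b" "E *v b = e' *\<^sub>R a" "a v* E = e' *\<^sub>R b"
    by blast
  have na: "inner a a = 1" "inner b b = 1" using new by (auto simp: norm_eq_1)
  have oa: "inner a (u i) = 0" "inner (u i) a = 0" "inner b (v i) = 0" "inner (v i) b = 0" if "i < r" for i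
    using new that unfolding U_def V_def by (auto simp: inner_commute)
  show ?case
    by (rule exI[of _ "u(r := a)"], rule exI[of _ "v(r := b)"], rule exI[of _ "x(r := x')"],
        rule exI[of _ "e(r := e')"])
       (auto simp: less_Suc_eq ou ov sv new na oa)
qed

section \<open>Orthonormal families and rank-one expansions\<close>

lemma Bessel_inequality:
  fixes u :: "nat \<Rightarrow> 'a::real_inner"
  assumes fin: "finite T"
    and o: "\<And>i j. i \<in> T \<Longrightarrow> j \<in> T \<Longrightarrow> inner (u i) (u j) = (if i = j then 1 else 0)"
  shows "(\<Sum>i\<in>T. (inner (u i) a)\<^sup>2) \<le> inner a a"
proof -
  let ?p = "\<Sum>i\<in>T. inner (u i) a *\<^sub>R u i"
  have 1: "inner ?p a = (\<Sum>i\<in>T. (inner (u i) a)\<^sup>2)"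
    by (simp add: inner_sum_left power2_eq_square)
  have "inner ?p ?p = (\<Sum>i\<in>T. \<Sum>j\<in>T. inner (u i) a * (inner (u j) a * inner (u i) (u j)))"
    by (simp add: inner_sum_left inner_sum_right sum_distrib_left inner_commute mult.left_commute)
  also have "\<dots> = (\<Sum>i\<in>T. \<Sum>j\<in>T. if i = j then inner (u i) a * inner (u j) a else 0)"
    by (intro sum.cong refl) (simp add: o)
  also have "\<dots> = (\<Sum>i\<in>T. (inner (u i) a)\<^sup>2)"
    using fin by (simp add: power2_eq_square)
  finally have 2: "inner ?p ?p = (\<Sum>i\<in>T. (inner (u i) a)\<^sup>2)" .
  have "0 \<le> inner (a - ?p) (a - ?p)" by simp
  also have "\<dots> = inner a a - 2 * inner ?p a + inner ?p ?p"
    by (simp add: inner_diff_left inner_diff_right inner_commute)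
  finally show ?thesis using 1 2 by simp
qed

lemma inner_outer_vec: "inner X (outer_vec p q) = inner p (X *v q)"
  by (simp add: outer_vec_def inner_vec_def matrix_vector_mult_def sum_distrib_left mult_ac)

lemma outer_vec_mult_vec: "outer_vec p q *v b = inner q b *\<^sub>R p"
  by (simp add: outer_vec_def inner_vec_def matrix_vector_mult_def vec_eq_iff sum_distrib_left mult_ac)

lemma inner_outer_vec_outer_vec: "inner (outer_vec a b) (outer_vec p q) = inner a p * inner b q"
  by (simp add: inner_outer_vec outer_vec_mult_vec inner_commute)

lemma sum_matrix_vector_mult: "(\<Sum>i\<in>T. M i) *v b = (\<Sum>i\<in>T. (M i :: real^'n^'m) *v b)"
  by (induction T rule: infinite_finite_induct) (auto simp: matrix_vector_mult_add_rdistrib)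

text \<open>The \<open>CARD('m)\<close> left vectors form an orthonormal basis of
  \<open>real^'m\<close>, so the vectors \<open>u i v* X\<close> determine \<open>X\<close>.\<close>

lemma singular_vector_expansion:
  fixes X :: "real^'n^'m" and u :: "nat \<Rightarrow> real^'m"
  assumes o: "\<And>i j. i < CARD('m) \<Longrightarrow> j < CARD('m) \<Longrightarrow> inner (u i) (u j) = (if i = j then 1 else 0)"
    and sv: "\<And>i. i < CARD('m) \<Longrightarrow> u i v* X = x i *\<^sub>R v i"
  shows "X = (\<Sum>i<CARD('m). x i *\<^sub>R outer_vec (u i) (v i))" (is "X = ?R")
proof -
  have eq: "inner (u i) (X *v b) = inner (u i) (?R *v b)" if i: "i < CARD('m)" for i b
  proof -
    have "inner (u i) (X *v b) = inner (u i v* X) b"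
      by (simp add: dot_lmul_matrix)
    also have "\<dots> = x i * inner (v i) b" using sv[OF i] by simp
    also have "\<dots> = (\<Sum>l<CARD('m). if l = i then x l * inner (v l) b else 0)"
      using i by simp
    also have "\<dots> = (\<Sum>l<CARD('m). x l * (inner (v l) b * inner (u i) (u l)))"
      using i by (intro sum.cong refl) (auto simp: o)
    also have "\<dots> = inner (u i) (?R *v b)"
      by (simp add: sum_matrix_vector_mult scaleR_matrix_vector_assoc[symmetric] outer_vec_mult_vec inner_sum_right mult.assoc)
    finally show ?thesis .
  qed
  have "X *v b = ?R *v b" for b
  proof (rule ccontr)
    assume ne: "X *v b \<noteq> ?R *v b"
    define a where "a = X *v b - ?R *v b"
    define a' where "a' = (1 / norm a) *\<^sub>R a"
    have a0: "a \<noteq> 0" using ne by (simp add: a_def)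
    have ort: "inner (u i) a' = 0" if "i < CARD('m)" for i
      using eq[OF that, of b] by (simp add: a'_def a_def inner_diff_right)
    have n1: "inner a' a' = 1"
      unfolding a'_def using a0 by (simp add: dot_square_norm power2_eq_square)
    \<comment> \<open>A discrepancy orthogonal to all left vectors is adjoined at index
      \<open>CARD('m)\<close>; this makes one orthonormal vector more than the dimension
      admits.\<close>
    define u' where "u' i = (if i < CARD('m) then u i else a')" for i
    have on: "inner (u' i) (u' j) = (if i = j then 1 else 0)" if "i \<le> CARD('m)" "j \<le> CARD('m)" for i j
      using that ort n1 by (auto simp: u'_def o inner_commute)
    let ?A = "{..CARD('m)}"
    have inj: "inj_on u' ?A"
      using on by (intro inj_onI) (metis atMost_iff zero_neq_one)
    have "pairwise orthogonal (u' ` ?A)"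
      using on by (auto simp: pairwise_def orthogonal_def)
    moreover have "0 \<notin> u' ` ?A"
      using on by (metis (no_types, lifting) atMost_iff image_iff inner_zero_left zero_neq_one)
    ultimately have "independent (u' ` ?A)"
      by (rule pairwise_orthogonal_independent)
    then have "card (u' ` ?A) \<le> DIM(real^'m)"
      by (rule independent_bound[THEN conjunct2])
    then show False using card_image[OF inj] by simp
  qed
  then show ?thesis by (simp add: matrix_eq)
qed

text \<open>No sign or order is imposed on \<open>x\<close> and \<open>e\<close>: in a common frame
  the two coefficient sequences cannot in general both be made nonnegative and decreasing.\<close>

lemma simultaneous_SVD:
  fixes X E :: "real^'n^'m"
  assumes mn: "CARD('m) \<le> CARD('n)"
    and c1: "\<And>a. X *v (a v* E) = E *v (a v* X)"
    and c2: "\<And>b. (E *v b) v* X = (X *v b) v* E"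
  obtains u :: "nat \<Rightarrow> real^'m" and v :: "nat \<Rightarrow> real^'n" and x e where
    "\<And>i j. i < CARD('m) \<Longrightarrow> j < CARD('m) \<Longrightarrow> inner (u i) (u j) = (if i = j then 1 else 0)"
    "\<And>i j. i < CARD('m) \<Longrightarrow> j < CARD('m) \<Longrightarrow> inner (v i) (v j) = (if i = j then 1 else 0)"
    "X = (\<Sum>i<CARD('m). x i *\<^sub>R outer_vec (u i) (v i))"
    "E = (\<Sum>i<CARD('m). e i *\<^sub>R outer_vec (u i) (v i))"
proof -
  obtain u :: "nat \<Rightarrow> real^'m" and v :: "nat \<Rightarrow> real^'n" and x e where
    o: "\<And>i j. i < CARD('m) \<Longrightarrow> j < CARD('m) \<Longrightarrow> inner (u i) (u j) = (if i = j then 1 else 0)"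
    "\<And>i j. i < CARD('m) \<Longrightarrow> j < CARD('m) \<Longrightarrow> inner (v i) (v j) = (if i = j then 1 else 0)" and
    sv: "\<And>i. i < CARD('m) \<Longrightarrow> u i v* X = x i *\<^sub>R v i"
     "\<And>i. i < CARD('m) \<Longrightarrow> u i v* E = e i *\<^sub>R v i"
  proof -
    obtain u :: "nat \<Rightarrow> real^'m" and v :: "nat \<Rightarrow> real^'n" and x e where
      "\<forall>i<CARD('m). \<forall>j<CARD('m). inner (u i) (u j) = (if i = j then 1 else 0)"
      "\<forall>i<CARD('m). \<forall>j<CARD('m). inner (v i) (v j) = (if i = j then 1 else 0)"
      "\<forall>i<CARD('m). X *v v i = x i *\<^sub>R u i \<and> u i v* X = x i *\<^sub>R v i \<and>
           E *v v i = e i *\<^sub>R u i \<and> u i v* E = e i *\<^sub>R v i"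
      using simultaneous_singular_vectors[OF mn c1 c2 order_refl] by (elim exE conjE)
    then show ?thesis by (intro that[of u v x e]) blast+
  qed
  show ?thesis
    by (rule that[OF o singular_vector_expansion[OF o(1) sv(1)] singular_vector_expansion[OF o(1) sv(2)]])
qed

text \<open>\<open>sing_val\<close> is a choice and carries no information until existence is known.
  The expansion of \<open>X\<close> paired with itself is sorted by magnitude, and negative signs
  are moved into the left vectors.\<close>

lemma is_singular_values_exists:
  fixes X :: "real^'n^'m"
  assumes mn: "CARD('m) \<le> CARD('n)"
  shows "\<exists>s. is_singular_values X s"
proof (rule simultaneous_SVD[OF mn, of X X, OF refl refl])
  let ?m = "CARD('m)"
  fix u :: "nat \<Rightarrow> real^'m" and v :: "nat \<Rightarrow> real^'n" and x e
  assume ou: "\<And>i j. i < ?m \<Longrightarrow> j < ?m \<Longrightarrow> inner (u i) (u j) = (if i = j then 1 else 0)"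
    and ov: "\<And>i j. i < ?m \<Longrightarrow> j < ?m \<Longrightarrow> inner (v i) (v j) = (if i = j then 1 else 0)"
    and X: "X = (\<Sum>i<?m. x i *\<^sub>R outer_vec (u i) (v i))"
  define xs where "xs = sort_key (\<lambda>i. - \<bar>x i\<bar>) [0..<?m]"
  define p where "p = (!) xs"
  have xs: "length xs = ?m" "set xs = {..<?m}" "distinct xs"
    unfolding xs_def by auto
  have bij: "bij_betw p {..<?m} {..<?m}"
    unfolding p_def by (rule bij_betw_nth[OF xs(3)]) (simp_all only: xs(1,2))
  then have pm: "p i < ?m" if "i < ?m" for i
    using that by (auto dest: bij_betwE)
  have pinj: "p i = p j \<longleftrightarrow> i = j" if "i < ?m" "j < ?m" for i j
    using bij that by (auto simp: bij_betw_def inj_on_def)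
  have srt: "sorted (map (\<lambda>i. - \<bar>x i\<bar>) xs)"
    unfolding xs_def by (rule sorted_sort_key)
  define sg where "sg i = (if x i < 0 then - 1 else 1 :: real)" for i
  define s where "s i = (if i < ?m then \<bar>x (p i)\<bar> else 0)" for i
  have "X = (\<Sum>i<?m. x (p i) *\<^sub>R outer_vec (u (p i)) (v (p i)))"
    unfolding X by (rule sum.reindex_bij_betw[OF bij, symmetric])
  also have "\<dots> = (\<Sum>i<?m. s i *\<^sub>R outer_vec (sg (p i) *\<^sub>R u (p i)) (v (p i)))"
    by (intro sum.cong refl) (auto simp: s_def sg_def outer_vec_def vec_eq_iff)
  finally have X': "X = (\<Sum>i<?m. s i *\<^sub>R outer_vec (sg (p i) *\<^sub>R u (p i)) (v (p i)))" .
  have o1: "\<forall>i<?m. \<forall>j<?m. inner (sg (p i) *\<^sub>R u (p i)) (sg (p j) *\<^sub>R u (p j)) = (if i = j then 1 else 0)"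
    using pm pinj by (auto simp: ou sg_def)
  have o2: "\<forall>i<?m. \<forall>j<?m. inner (v (p i)) (v (p j)) = (if i = j then 1 else 0)"
    using pm pinj by (auto simp: ov)
  have dec: "\<forall>i j. i \<le> j \<longrightarrow> j < ?m \<longrightarrow> s j \<le> s i"
  proof (intro allI impI)
    fix i j assume ij: "i \<le> j" "j < ?m"
    have "map (\<lambda>i. - \<bar>x i\<bar>) xs ! i \<le> map (\<lambda>i. - \<bar>x i\<bar>) xs ! j"
      using sorted_nth_mono[OF srt ij(1)] ij xs by simp
    then show "s j \<le> s i" using ij xs by (simp add: s_def p_def)
  qed
  have "is_singular_values X s"
    unfolding is_singular_values_def
    by (intro conjI exI[of _ "\<lambda>i. sg (p i) *\<^sub>R u (p i)"] exI[of _ "\<lambda>i. v (p i)"])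
       (use o1 o2 dec X' in \<open>simp_all add: s_def\<close>)
  then show ?thesis by blast
qed

section \<open>The Ky Fan norm cone\<close>

text \<open>A set of matrices of rank at most \<open>k\<close> whose support function is the Ky Fan norm; it is visibly stable under
  multiplication by contractions.\<close>

definition contractive_family :: "nat set \<Rightarrow> (nat \<Rightarrow> 'a::real_inner) \<Rightarrow> bool" where
  "contractive_family T p \<longleftrightarrow> (\<forall>a. (\<Sum>i\<in>T. (inner (p i) a)\<^sup>2) \<le> inner a a)"

definition kyfan_dual :: "nat \<Rightarrow> (real^'n^'m) set" where
  "kyfan_dual k = {\<Sum>i\<in>T. outer_vec (p i) (q i) | T p q.
     finite T \<and> card T \<le> k \<and> contractive_family T p \<and> contractive_family T q}"

lemma kyfan_dualI:
  assumes "finite T" "card T \<le> k" "contractive_family T p" "contractive_family T q"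
  shows "(\<Sum>i\<in>T. outer_vec (p i) (q i)) \<in> kyfan_dual k"
  unfolding kyfan_dual_def mem_Collect_eq using assms
  by (intro exI[of _ T] exI[of _ p] exI[of _ q]) simp

lemma contractive_family_norm_le_1:
  assumes "finite T" "contractive_family T p" "i \<in> T"
  shows "inner (p i) (p i) \<le> 1"
proof (rule ccontr)
  let ?n = "inner (p i) (p i)"
  assume n: "\<not> ?n \<le> 1"
  have "?n\<^sup>2 \<le> (\<Sum>j\<in>T. (inner (p j) (p i))\<^sup>2)"
    using assms by (intro member_le_sum) auto
  also have "\<dots> \<le> ?n" using assms unfolding contractive_family_def by blast
  finally have "?n * ?n \<le> ?n * 1" by (simp add: power2_eq_square)
  then have "?n \<le> 1" by (rule mult_left_le_imp_le) (use n in linarith)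
  then show False using n by simp
qed

lemma contractive_family_orthonormal:
  assumes "finite T" "\<And>i j. i \<in> T \<Longrightarrow> j \<in> T \<Longrightarrow> inner (u i) (u j) = (if i = j then 1 else 0)"
  shows "contractive_family T u"
  unfolding contractive_family_def using Bessel_inequality[OF assms] by blast

text \<open>The inequality between the arithmetic and the geometric mean separates left from right
  factors. Summation over \<open>T\<close> then uses contractivity and bounds a single coefficient;
  summation over \<open>I\<close> uses Bessel for \<open>u\<close> and \<open>v\<close> and bounds
  by 1 the share of each of the at most \<open>k\<close> terms of \<open>Z\<close>.\<close>

lemma kyfan_dual_coefficients:
  fixes u :: "nat \<Rightarrow> real^'m" and v :: "nat \<Rightarrow> real^'n"
  assumes I: "finite I"
    and ou: "\<And>i j. i \<in> I \<Longrightarrow> j \<in> I \<Longrightarrow> inner (u i) (u j) = (if i = j then 1 else 0)"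
    and ov: "\<And>i j. i \<in> I \<Longrightarrow> j \<in> I \<Longrightarrow> inner (v i) (v j) = (if i = j then 1 else 0)"
    and Z: "Z \<in> kyfan_dual k"
  shows "\<And>l. l \<in> I \<Longrightarrow> \<bar>inner (outer_vec (u l) (v l)) Z\<bar> \<le> 1"
    and "(\<Sum>l\<in>I. \<bar>inner (outer_vec (u l) (v l)) Z\<bar>) \<le> real k"
proof -
  obtain T and p :: "nat \<Rightarrow> real^'m" and q :: "nat \<Rightarrow> real^'n" where
    Zeq: "Z = (\<Sum>i\<in>T. outer_vec (p i) (q i))" and T: "finite T" "card T \<le> k"
    and p: "contractive_family T p" and q: "contractive_family T q"
    using Z unfolding kyfan_dual_def by blast
  have c: "\<bar>inner (outer_vec (u l) (v l)) Z\<bar>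
      \<le> (\<Sum>i\<in>T. (inner (p i) (u l))\<^sup>2 / 2 + (inner (q i) (v l))\<^sup>2 / 2)" for l
  proof -
    have am: "\<bar>x * y\<bar> \<le> x\<^sup>2 / 2 + y\<^sup>2 / 2" for x y :: real
      using sum_squares_bound[of "\<bar>x\<bar>" "\<bar>y\<bar>"] by (simp add: abs_mult)
    have "inner (outer_vec (u l) (v l)) Z = (\<Sum>i\<in>T. inner (p i) (u l) * inner (q i) (v l))"
      unfolding Zeq by (simp add: inner_sum_right inner_outer_vec_outer_vec inner_commute)
    also have "\<bar>\<dots>\<bar> \<le> (\<Sum>i\<in>T. \<bar>inner (p i) (u l) * inner (q i) (v l)\<bar>)"
      by (rule sum_abs)
    also have "\<dots> \<le> (\<Sum>i\<in>T. (inner (p i) (u l))\<^sup>2 / 2 + (inner (q i) (v l))\<^sup>2 / 2)"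
      by (intro sum_mono am)
    finally show ?thesis .
  qed
  show "\<bar>inner (outer_vec (u l) (v l)) Z\<bar> \<le> 1" if l: "l \<in> I" for l
  proof -
    have "(\<Sum>i\<in>T. (inner (p i) (u l))\<^sup>2) \<le> 1" "(\<Sum>i\<in>T. (inner (q i) (v l))\<^sup>2) \<le> 1"
      using p[unfolded contractive_family_def, rule_format, of "u l"]
        q[unfolded contractive_family_def, rule_format, of "v l"] ou[OF l l] ov[OF l l] by simp_all
    then show ?thesis using c[of l] by (simp add: sum.distrib sum_divide_distrib[symmetric])
  qed
  have "(\<Sum>l\<in>I. \<bar>inner (outer_vec (u l) (v l)) Z\<bar>)
      \<le> (\<Sum>l\<in>I. \<Sum>i\<in>T. (inner (p i) (u l))\<^sup>2 / 2 + (inner (q i) (v l))\<^sup>2 / 2)"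
    by (intro sum_mono c)
  also have "\<dots> = (\<Sum>i\<in>T. (\<Sum>l\<in>I. (inner (u l) (p i))\<^sup>2) / 2 + (\<Sum>l\<in>I. (inner (v l) (q i))\<^sup>2) / 2)"
    by (subst sum.swap) (simp add: sum.distrib sum_divide_distrib inner_commute)
  also have "\<dots> \<le> (\<Sum>i\<in>T. inner (p i) (p i) / 2 + inner (q i) (q i) / 2)"
    by (intro sum_mono add_mono divide_right_mono Bessel_inequality I ou ov) auto
  also have "\<dots> \<le> (\<Sum>i\<in>T. 1)"
  proof (intro sum_mono)
    fix i assume "i \<in> T"
    then show "inner (p i) (p i) / 2 + inner (q i) (q i) / 2 \<le> 1"
      using contractive_family_norm_le_1[OF T(1) p] contractive_family_norm_le_1[OF T(1) q] by fastforce
  qed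
  also have "\<dots> \<le> real k" using T by simp
  finally show "(\<Sum>l\<in>I. \<bar>inner (outer_vec (u l) (v l)) Z\<bar>) \<le> real k" .
qed

text \<open>Linear programming duality with \<open>\<theta>\<close> as the price of weight: a unit
  of weight withheld in \<open>T\<close> loses at least \<open>\<theta>\<close>, a unit spent
  outside gains at most \<open>\<theta>\<close>, and the total weight is at most
  \<open>card T\<close>.\<close>

lemma weighted_sum_le_top_sum:
  fixes c x :: "nat \<Rightarrow> real"
  assumes I: "finite I" and T: "T \<subseteq> I" "card T = k" and \<theta>: "0 \<le> \<theta>"
    and top: "\<And>l. l \<in> T \<Longrightarrow> \<theta> \<le> \<bar>x l\<bar>" "\<And>l. l \<in> I - T \<Longrightarrow> \<bar>x l\<bar> \<le> \<theta>"
    and c: "\<And>l. l \<in> I \<Longrightarrow> \<bar>c l\<bar> \<le> 1" "(\<Sum>l\<in>I. \<bar>c l\<bar>) \<le> real k"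
  shows "(\<Sum>l\<in>I. c l * x l) \<le> (\<Sum>l\<in>T. \<bar>x l\<bar>)"
proof -
  have split: "(\<Sum>l\<in>I. g l) = (\<Sum>l\<in>T. g l) + (\<Sum>l\<in>I - T. g l)" for g :: "nat \<Rightarrow> real"
    using sum.subset_diff[OF T(1) I, of g] by simp
  have "(\<Sum>l\<in>I. c l * x l) \<le> (\<Sum>l\<in>I. \<bar>c l\<bar> * \<bar>x l\<bar>)"
    by (intro sum_mono) (metis abs_ge_self abs_mult)
  also have "\<dots> = (\<Sum>l\<in>T. \<bar>c l\<bar> * \<bar>x l\<bar>) + (\<Sum>l\<in>I - T. \<bar>c l\<bar> * \<bar>x l\<bar>)" by (rule split)
  also have "\<dots> \<le> (\<Sum>l\<in>T. \<bar>x l\<bar> - (1 - \<bar>c l\<bar>) * \<theta>) + (\<Sum>l\<in>I - T. \<bar>c l\<bar> * \<theta>)"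
  proof (intro add_mono sum_mono)
    fix l assume l: "l \<in> T"
    have "(1 - \<bar>c l\<bar>) * \<theta> \<le> (1 - \<bar>c l\<bar>) * \<bar>x l\<bar>"
      using top(1)[OF l] c(1) l T(1) by (intro mult_left_mono) auto
    then show "\<bar>c l\<bar> * \<bar>x l\<bar> \<le> \<bar>x l\<bar> - (1 - \<bar>c l\<bar>) * \<theta>" by (simp add: algebra_simps)
  next
    fix l assume "l \<in> I - T"
    then show "\<bar>c l\<bar> * \<bar>x l\<bar> \<le> \<bar>c l\<bar> * \<theta>" using top(2) by (intro mult_left_mono) auto
  qed
  also have "\<dots> = (\<Sum>l\<in>T. \<bar>x l\<bar>) + \<theta> * ((\<Sum>l\<in>I. \<bar>c l\<bar>) - real k)"
    using T(2) 
    by (simp add: split sum_subtractf sum.distrib sum_distrib_left[symmetric] algebra_simps)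
  also have "\<dots> \<le> (\<Sum>l\<in>T. \<bar>x l\<bar>)"
    using \<theta> c(2) by (simp add: mult_nonneg_nonpos)
  finally show ?thesis .
qed

lemma ex_top_subset:
  fixes x :: "nat \<Rightarrow> real"
  assumes "finite I" "k \<le> card I"
  shows "\<exists>T \<theta>. T \<subseteq> I \<and> card T = k \<and> 0 \<le> \<theta> \<and> (\<forall>l\<in>T. \<theta> \<le> \<bar>x l\<bar>) \<and> (\<forall>l\<in>I - T. \<bar>x l\<bar> \<le> \<theta>)"
  using assms(2)
proof (induction k)
  case 0
  show ?case
  proof (cases "I = {}")
    case False
    \<comment> \<open>While nothing is selected, any upper bound of the magnitudes is a threshold;
      their sum is one.\<close>
    then show ?thesis
      using assms(1)
      by (intro exI[of _ "{}"] exI[of _ "\<Sum>l\<in>I. \<bar>x l\<bar>"]) (auto simp: sum_nonneg intro: member_le_sum)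
  qed auto
next
  case (Suc k)
  then obtain T \<theta> where T: "T \<subseteq> I" "card T = k" "\<forall>l\<in>T. \<theta> \<le> \<bar>x l\<bar>" "\<forall>l\<in>I - T. \<bar>x l\<bar> \<le> \<theta>"
    by auto
  have fT: "finite T" using T(1) assms(1) finite_subset by blast
  have "I \<noteq> T" using T(2) Suc.prems by auto
  then have "I - T \<noteq> {}" using T(1) by blast
  then have "Max ((\<lambda>l. \<bar>x l\<bar>) ` (I - T)) \<in> (\<lambda>l. \<bar>x l\<bar>) ` (I - T)"
    using assms(1) by (intro Max_in) auto
  then obtain m where m1: "m \<in> I - T" "Max ((\<lambda>l. \<bar>x l\<bar>) ` (I - T)) = \<bar>x m\<bar>"
    by blast
  have m2: "\<bar>x l\<bar> \<le> \<bar>x m\<bar>" if "l \<in> I - T" for l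
    unfolding m1(2)[symmetric] using assms(1) that by (intro Max_ge) auto
  note m = m1(1) m2
  have "card (insert m T) = Suc k" using m(1) fT T(2) by simp
  moreover have "\<bar>x m\<bar> \<le> \<bar>x l\<bar>" if "l \<in> insert m T" for l
    using that T(3)[rule_format, of l] T(4)[rule_format, OF m(1)] by (cases "l = m") auto
  ultimately show ?case
    using T(1) m by (intro exI[of _ "insert m T"] exI[of _ "\<bar>x m\<bar>"]) auto
qed

text \<open>Such elements maximise the inner product with matrices expanded in the frame
  \<open>u\<close>, \<open>v\<close>; the signs, absorbed by the left vectors, make negative
  coefficients count with their absolute values.\<close>

lemma signed_partial_isometry_in_kyfan_dual:
  fixes u :: "nat \<Rightarrow> real^'m" and v :: "nat \<Rightarrow> real^'n"
  assumes T: "finite T" "card T \<le> k"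
    and ou: "\<And>i j. i \<in> T \<Longrightarrow> j \<in> T \<Longrightarrow> inner (u i) (u j) = (if i = j then 1 else 0)"
    and ov: "\<And>i j. i \<in> T \<Longrightarrow> j \<in> T \<Longrightarrow> inner (v i) (v j) = (if i = j then 1 else 0)"
    and \<epsilon>: "\<And>i. i \<in> T \<Longrightarrow> \<epsilon> i * \<epsilon> i = (1::real)"
  shows "(\<Sum>i\<in>T. \<epsilon> i *\<^sub>R outer_vec (u i) (v i)) \<in> kyfan_dual k"
proof -
  have "\<epsilon> i *\<^sub>R outer_vec (u i) (v i) = outer_vec (\<epsilon> i *\<^sub>R u i) (v i)" for i
    by (simp add: outer_vec_def vec_eq_iff)
  moreover have "contractive_family T (\<lambda>i. \<epsilon> i *\<^sub>R u i)" "contractive_family T v"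
    using T ou ov \<epsilon> by (auto intro!: contractive_family_orthonormal)
  ultimately show ?thesis
    using kyfan_dualI[OF T] by simp
qed

lemma inner_expansion_signed:
  fixes u :: "nat \<Rightarrow> real^'m" and v :: "nat \<Rightarrow> real^'n"
  assumes I: "finite I" "T \<subseteq> I"
    and ou: "\<And>i j. i \<in> I \<Longrightarrow> j \<in> I \<Longrightarrow> inner (u i) (u j) = (if i = j then 1 else 0)"
    and ov: "\<And>i j. i \<in> I \<Longrightarrow> j \<in> I \<Longrightarrow> inner (v i) (v j) = (if i = j then 1 else 0)"
  shows "inner (\<Sum>i\<in>I. x i *\<^sub>R outer_vec (u i) (v i)) (\<Sum>i\<in>T. \<epsilon> i *\<^sub>R outer_vec (u i) (v i))
     = (\<Sum>i\<in>T. \<epsilon> i * x i)"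
proof -
  have "inner (\<Sum>i\<in>I. x i *\<^sub>R outer_vec (u i) (v i)) (\<Sum>j\<in>T. \<epsilon> j *\<^sub>R outer_vec (u j) (v j))
      = (\<Sum>j\<in>T. \<Sum>i\<in>I. \<epsilon> j * (x i * (inner (u i) (u j) * inner (v i) (v j))))"
    by (simp add: inner_sum_left inner_sum_right inner_outer_vec_outer_vec sum_distrib_left)
  also have "\<dots> = (\<Sum>j\<in>T. \<Sum>i\<in>I. if i = j then \<epsilon> j * x i else 0)"
    using I by (intro sum.cong refl) (auto simp: ou ov subset_iff)
  also have "\<dots> = (\<Sum>j\<in>T. \<epsilon> j * x j)"
    using I by (intro sum.cong refl) auto
  finally show ?thesis .
qed

text \<open>Ky Fan's maximum principle. The coefficient bounds 1 and \<open>k\<close> prevent a dual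
  element from exceeding the sum of the \<open>k\<close> largest singular values, and the partial
  isometry on the first \<open>k\<close> singular pairs attains it.\<close>

lemma kyfan_cone_iff:
  fixes X :: "real^'n^'m"
  assumes mn: "CARD('m) \<le> CARD('n)" and k: "k \<le> CARD('m)"
  shows "(t, X) \<in> kyfan_cone k \<longleftrightarrow> (\<forall>Z\<in>kyfan_dual k. inner X Z \<le> t)"
proof -
  let ?m = "CARD('m)"
  let ?s = "sing_val X"
  have "is_singular_values X ?s"
    unfolding sing_val_def by (rule someI_ex[OF is_singular_values_exists[OF mn]])
  then obtain u :: "nat \<Rightarrow> real^'m" and v :: "nat \<Rightarrow> real^'n" where
    sv: "\<forall>i<?m. \<forall>j<?m. inner (u i) (u j) = (if i = j then 1 else 0)"
      "\<forall>i<?m. \<forall>j<?m. inner (v i) (v j) = (if i = j then 1 else 0)" and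
    X: "X = (\<Sum>i<?m. ?s i *\<^sub>R outer_vec (u i) (v i))" and
    mono: "\<forall>i j. i \<le> j \<longrightarrow> j < ?m \<longrightarrow> ?s j \<le> ?s i" "\<forall>i<?m. 0 \<le> ?s i"
    unfolding is_singular_values_def by (elim exE conjE)
  have ou: "inner (u i) (u j) = (if i = j then 1 else 0)" if "i \<in> {..<?m}" "j \<in> {..<?m}" for i j
    using sv(1) that by blast
  have ov: "inner (v i) (v j) = (if i = j then 1 else 0)" if "i \<in> {..<?m}" "j \<in> {..<?m}" for i j
    using sv(2) that by blast
  have dec: "?s j \<le> ?s i" if "i \<le> j" "j < ?m" for i j
    using mono that by blast
  have nn: "0 \<le> ?s i" if "i < ?m" for i
    using mono that by blast
  have up: "inner X Z \<le> kyfan_norm k X" if Z: "Z \<in> kyfan_dual k" for Z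
  proof -
    let ?c = "\<lambda>l. inner (outer_vec (u l) (v l)) Z"
    \<comment> \<open>Indices start at 0, so \<open>?s (k - 1)\<close> is the \<open>k\<close>-th
      singular value, the smallest one selected. For \<open>k = 0\<close> the largest one bounds
      everything left out.\<close>
    define \<theta> where "\<theta> = (if k = 0 then ?s 0 else ?s (k - 1))"
    have "inner X Z = (\<Sum>l<?m. ?c l * ?s l)"
      by (subst X) (simp add: inner_sum_left mult.commute)
    also have "\<dots> \<le> (\<Sum>l<k. \<bar>?s l\<bar>)"
    proof (rule weighted_sum_le_top_sum[where \<theta> = \<theta>])
      show "0 \<le> \<theta>" using nn k by (auto simp: \<theta>_def)
      show "\<theta> \<le> \<bar>?s l\<bar>" if "l \<in> {..<k}" for l
        using that dec[of l "k - 1"] k unfolding \<theta>_def by fastforce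
      show "\<bar>?s l\<bar> \<le> \<theta>" if "l \<in> {..<?m} - {..<k}" for l
        using that dec[of "k - 1" l] dec[of 0 l] nn[of l] by (auto simp: \<theta>_def)
      show "\<bar>?c l\<bar> \<le> 1" if "l \<in> {..<?m}" for l
        by (rule kyfan_dual_coefficients(1)[OF _ ou ov Z that]) auto
      show "(\<Sum>l<?m. \<bar>?c l\<bar>) \<le> real k"
        by (rule kyfan_dual_coefficients(2)[OF _ ou ov Z]) auto
    qed (use k in auto)
    also have "\<dots> = kyfan_norm k X"
      unfolding kyfan_norm_def using nn k by (intro sum.cong) auto
    finally show ?thesis .
  qed
  let ?Z = "\<Sum>i<k. (1::real) *\<^sub>R outer_vec (u i) (v i)"
  have Z: "?Z \<in> kyfan_dual k"
    using ou ov k by (intro signed_partial_isometry_in_kyfan_dual) auto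
  have "inner X ?Z = (\<Sum>i<k. 1 * ?s i)"
    by (subst X, rule inner_expansion_signed[OF _ _ ou ov]) (use k in auto)
  then have "inner X ?Z = kyfan_norm k X" by (simp add: kyfan_norm_def)
  then show ?thesis
    unfolding kyfan_cone_def using up Z by (auto intro: order_trans)
qed

lemma kyfan_cone_eq_Inter:
  assumes "CARD('m) \<le> CARD('n)" and "k \<le> CARD('m)"
  shows "(kyfan_cone k :: ('m::finite, 'n::finite) XX set)
    = (\<Inter>Z\<in>kyfan_dual k. {P. inner (- 1, Z) P \<le> 0})"
  using kyfan_cone_iff[OF assms] by (auto simp: inner_commute)

lemma closed_kyfan_cone:
  assumes "CARD('m) \<le> CARD('n)" and "k \<le> CARD('m)"
  shows "closed (kyfan_cone k :: ('m::finite, 'n::finite) XX set)"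
  unfolding kyfan_cone_eq_Inter[OF assms] by (intro closed_INT ballI closed_halfspace_le)

lemma convex_kyfan_cone:
  assumes "CARD('m) \<le> CARD('n)" and "k \<le> CARD('m)"
  shows "convex (kyfan_cone k :: ('m::finite, 'n::finite) XX set)"
  unfolding kyfan_cone_eq_Inter[OF assms] by (intro convex_INT convex_halfspace_le)

section \<open>Two-sided matrix multiplication on the cone\<close>

lemma inner_matrix_mult_left: "inner (A ** X) E = inner A (E ** transpose X)"
  for A :: "real^'m^'m" and X E :: "real^'n^'m"
proof -
  have "inner (A ** X) E = (\<Sum>i\<in>UNIV. \<Sum>j\<in>UNIV. \<Sum>l\<in>UNIV. A$i$l * X$l$j * E$i$j)"
    by (simp add: inner_vec_def matrix_matrix_mult_def sum_distrib_right)
  also have "\<dots> = (\<Sum>i\<in>UNIV. \<Sum>l\<in>UNIV. \<Sum>j\<in>UNIV. A$i$l * X$l$j * E$i$j)"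
    by (intro sum.cong refl, rule sum.swap)
  also have "\<dots> = inner A (E ** transpose X)"
    by (simp add: inner_vec_def matrix_matrix_mult_def transpose_def sum_distrib_left mult_ac)
  finally show ?thesis .
qed

lemma inner_transpose: "inner (transpose A) (transpose B) = inner A B" for A :: "real^'n^'m"
  by (simp add: inner_vec_def transpose_def) (rule sum.swap)

lemma inner_matrix_mult_right: "inner (X ** B) E = inner B (transpose X ** E)"
  for B :: "real^'n^'n" and X E :: "real^'n^'m"
proof -
  have "inner (X ** B) E = inner (transpose B ** transpose X) (transpose E)"
    by (simp add: matrix_transpose_mul[symmetric] inner_transpose)
  also have "\<dots> = inner (transpose B) (transpose (transpose X ** E))"
    by (simp add: inner_matrix_mult_left matrix_transpose_mul)
  finally show ?thesis by (simp add: inner_transpose)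
qed

text \<open>The multiplication is moved to the dual side: rescaled images of the \<open>p i\<close>
  and \<open>q i\<close> under the transposes form another element of \<open>kyfan_dual k\<close>,
  against which \<open>Y\<close> is already bounded by \<open>s\<close>.\<close>

lemma kyfan_cone_mult:
  fixes M :: "real^'m^'m" and N :: "real^'n^'n" and Y :: "real^'n^'m"
  assumes mn: "CARD('m) \<le> CARD('n)" and k: "k \<le> CARD('m)" and \<kappa>: "0 < \<kappa>"
    and M: "\<And>a. inner (M *v a) (M *v a) \<le> \<kappa> * inner a a"
    and N: "\<And>b. inner (N *v b) (N *v b) \<le> \<kappa> * inner b b"
    and Y: "(s, Y) \<in> kyfan_cone k"
  shows "(\<kappa> * s, M ** Y ** transpose N) \<in> kyfan_cone k"
  unfolding kyfan_cone_iff[OF mn k]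
proof
  fix Z :: "real^'n^'m" assume "Z \<in> kyfan_dual k"
  then obtain T and p :: "nat \<Rightarrow> real^'m" and q :: "nat \<Rightarrow> real^'n" where
    Z: "Z = (\<Sum>i\<in>T. outer_vec (p i) (q i))" and T: "finite T" "card T \<le> k"
    and p: "contractive_family T p" and q: "contractive_family T q"
    unfolding kyfan_dual_def by blast
  \<comment> \<open>One factor \<open>c\<close> on each side makes both families contractive;
    together they contribute \<open>1 / \<kappa>\<close>, so \<open>\<kappa>\<close> enters the
    conclusion only once.\<close>
  define c where "c = 1 / sqrt \<kappa>"
  have c: "c * c = 1 / \<kappa>" using \<kappa> by (simp add: c_def)
  have p': "contractive_family T (\<lambda>i. c *\<^sub>R (p i v* M))"
    unfolding contractive_family_def
  proof
    fix a
    have "(\<Sum>i\<in>T. (inner (c *\<^sub>R (p i v* M)) a)\<^sup>2) = (\<Sum>i\<in>T. (inner (p i) (M *v a))\<^sup>2) * (c * c)"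
      by (simp add: dot_lmul_matrix power2_eq_square sum_distrib_left mult_ac)
    also have "\<dots> \<le> (\<kappa> * inner a a) * (c * c)"
      using order_trans[OF p[unfolded contractive_family_def, rule_format] M[of a]]
      by (intro mult_right_mono) auto
    finally show "(\<Sum>i\<in>T. (inner (c *\<^sub>R (p i v* M)) a)\<^sup>2) \<le> inner a a"
      using \<kappa> by (simp add: c)
  qed
  have q': "contractive_family T (\<lambda>i. c *\<^sub>R (q i v* N))"
    unfolding contractive_family_def
  proof
    fix a
    have "(\<Sum>i\<in>T. (inner (c *\<^sub>R (q i v* N)) a)\<^sup>2) = (\<Sum>i\<in>T. (inner (q i) (N *v a))\<^sup>2) * (c * c)"
      by (simp add: dot_lmul_matrix power2_eq_square sum_distrib_left mult_ac)
    also have "\<dots> \<le> (\<kappa> * inner a a) * (c * c)"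
      using order_trans[OF q[unfolded contractive_family_def, rule_format] N[of a]]
      by (intro mult_right_mono) auto
    finally show "(\<Sum>i\<in>T. (inner (c *\<^sub>R (q i v* N)) a)\<^sup>2) \<le> inner a a"
      using \<kappa> by (simp add: c)
  qed
  define Z' where "Z' = (\<Sum>i\<in>T. outer_vec (c *\<^sub>R (p i v* M)) (c *\<^sub>R (q i v* N)))"
  have "Z' \<in> kyfan_dual k"
    unfolding Z'_def by (rule kyfan_dualI[OF T p' q'])
  then have "inner Y Z' \<le> s" using Y unfolding kyfan_cone_iff[OF mn k] by blast
  moreover have "inner Y Z' = inner (M ** Y ** transpose N) Z / \<kappa>"
  proof -
    have "inner Y (outer_vec (c *\<^sub>R (p i v* M)) (c *\<^sub>R (q i v* N)))
        = inner (M ** Y ** transpose N) (outer_vec (p i) (q i)) * (c * c)" for i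
      by (simp add: inner_outer_vec dot_lmul_matrix matrix_vector_mult_scaleR
          matrix_vector_mul_assoc[symmetric])
    then show ?thesis
      unfolding Z'_def Z by (simp add: inner_sum_right sum_divide_distrib c)
  qed
  ultimately show "inner (M ** Y ** transpose N) Z \<le> \<kappa> * s"
    using \<kappa> by (simp add: divide_le_eq mult.commute)
qed

section \<open>Orbit regularity of the Ky Fan cone\<close>

text \<open>Within a fixed frame every dual element is dominated by one of finitely many signed
  partial isometries. Those active at \<open>X\<close> stay satisfied by \<open>act\<close>, the
  others keep their slack for small \<open>t\<close>, and finiteness yields one
  \<open>\<epsilon>\<close> for all.\<close>

lemma kyfan_cone_ray:
  fixes u :: "nat \<Rightarrow> real^'m" and v :: "nat \<Rightarrow> real^'n"
  assumes mn: "CARD('m) \<le> CARD('n)" and k: "k \<le> CARD('m)"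
    and ou: "\<And>i j. i < CARD('m) \<Longrightarrow> j < CARD('m) \<Longrightarrow> inner (u i) (u j) = (if i = j then 1 else 0)"
    and ov: "\<And>i j. i < CARD('m) \<Longrightarrow> j < CARD('m) \<Longrightarrow> inner (v i) (v j) = (if i = j then 1 else 0)"
    and X: "X = (\<Sum>i<CARD('m). x i *\<^sub>R outer_vec (u i) (v i))"
    and E: "E = (\<Sum>i<CARD('m). e i *\<^sub>R outer_vec (u i) (v i))"
    and K: "(s, X) \<in> kyfan_cone k"
    and act: "\<And>Z. Z \<in> kyfan_dual k \<Longrightarrow> inner X Z = s \<Longrightarrow> inner E Z \<le> \<tau>"
  shows "\<exists>\<epsilon>>0. \<forall>t\<in>{0..\<epsilon>}. (s + t * \<tau>, X + t *\<^sub>R E) \<in> kyfan_cone k"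
proof -
  let ?I = "{..<CARD('m)}"
  have ouI: "inner (u i) (u j) = (if i = j then 1 else 0)" if "i \<in> ?I" "j \<in> ?I" for i j
    using ou that by simp
  have ovI: "inner (v i) (v j) = (if i = j then 1 else 0)" if "i \<in> ?I" "j \<in> ?I" for i j
    using ov that by simp
  define \<epsilon>' where "\<epsilon>' N i = (if i \<in> N then - 1 else 1 :: real)" for N and i :: nat
  define Zf where "Zf = (\<lambda>(T, N). \<Sum>i\<in>T. \<epsilon>' N i *\<^sub>R outer_vec (u i) (v i))"
  define \<J> where "\<J> = {(T, N). T \<subseteq> ?I \<and> card T = k \<and> N \<subseteq> ?I}"
  have fin: "finite \<J>"
    by (rule finite_subset[of _ "Pow ?I \<times> Pow ?I"]) (auto simp: \<J>_def)
  have Zf: "Zf p \<in> kyfan_dual k" if p: "p \<in> \<J>" for p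
  proof (cases p)
    case (Pair T N)
    have T: "T \<subseteq> ?I" "card T \<le> k" using p by (auto simp: Pair \<J>_def)
    show ?thesis
      unfolding Pair Zf_def prod.case
    proof (rule signed_partial_isometry_in_kyfan_dual[OF _ T(2)])
      show "finite T" using T(1) finite_subset by blast
    qed (use T(1) in \<open>auto simp: ou ov \<epsilon>'_def subset_iff\<close>)
  qed
  have ev: "eventually (\<lambda>t. inner (X + t *\<^sub>R E) (Zf p) \<le> s + t * \<tau>) (at_right 0)" if p: "p \<in> \<J>" for p
  proof (cases "inner X (Zf p) = s")
    case True
    then have le: "inner E (Zf p) \<le> \<tau>" using act Zf[OF p] by blast
    have "eventually (\<lambda>t::real. 0 < t) (at_right 0)" by (rule eventually_at_right_less)
    then show ?thesis
      by eventually_elim (use True le in \<open>simp add: inner_add_left mult_left_mono\<close>)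
  next
    case False
    have "inner X (Zf p) \<le> s" using K Zf[OF p] unfolding kyfan_cone_iff[OF mn k] by blast
    then have less: "inner X (Zf p) < s" using False by simp
    have "((\<lambda>t. s + t * \<tau> - inner (X + t *\<^sub>R E) (Zf p)) \<longlongrightarrow> s + 0 * \<tau> - inner (X + 0 *\<^sub>R E) (Zf p)) (at_right 0)"
      by (intro tendsto_intros)
    from order_tendstoD(1)[OF this, of 0] less
    have "eventually (\<lambda>t. 0 < s + t * \<tau> - inner (X + t *\<^sub>R E) (Zf p)) (at_right 0)" by simp
    then show ?thesis by eventually_elim simp
  qed
  have "eventually (\<lambda>t. \<forall>p\<in>\<J>. inner (X + t *\<^sub>R E) (Zf p) \<le> s + t * \<tau>) (at_right 0)"
    by (rule eventually_ball_finite[OF fin]) (use ev in blast)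
  then obtain b where b: "0 < b"
    "\<And>t p. 0 < t \<Longrightarrow> t < b \<Longrightarrow> p \<in> \<J> \<Longrightarrow> inner (X + t *\<^sub>R E) (Zf p) \<le> s + t * \<tau>"
    unfolding eventually_at_right_field by blast
  have mem: "(s + t * \<tau>, X + t *\<^sub>R E) \<in> kyfan_cone k" if t: "0 < t" "t < b" for t
    unfolding kyfan_cone_iff[OF mn k]
  proof
    fix Z :: "real^'n^'m" assume Z: "Z \<in> kyfan_dual k"
    define y where "y i = x i + t * e i" for i
    have Y: "X + t *\<^sub>R E = (\<Sum>i\<in>?I. y i *\<^sub>R outer_vec (u i) (v i))"
      unfolding X E y_def by (simp add: scaleR_sum_right sum.distrib scaleR_add_left)
    obtain T \<theta> where T: "T \<subseteq> ?I" "card T = k" "0 \<le> \<theta>"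
      and top: "\<forall>l\<in>T. \<theta> \<le> \<bar>y l\<bar>" "\<forall>l\<in>?I - T. \<bar>y l\<bar> \<le> \<theta>"
      using ex_top_subset[of ?I k y] k by auto
    define N where "N = {l \<in> T. y l < 0}"
    let ?c = "\<lambda>l. inner (outer_vec (u l) (v l)) Z"
    have "inner (X + t *\<^sub>R E) Z = (\<Sum>l\<in>?I. ?c l * y l)"
      unfolding Y by (simp add: inner_sum_left mult.commute)
    also have "\<dots> \<le> (\<Sum>l\<in>T. \<bar>y l\<bar>)"
    proof (rule weighted_sum_le_top_sum[OF _ T])
      show "\<bar>?c l\<bar> \<le> 1" if "l \<in> ?I" for l
        by (rule kyfan_dual_coefficients(1)[OF _ ouI ovI Z that]) auto
      show "(\<Sum>l\<in>?I. \<bar>?c l\<bar>) \<le> real k"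
        by (rule kyfan_dual_coefficients(2)[OF _ ouI ovI Z]) auto
    qed (use top in auto)
    also have "\<dots> = (\<Sum>l\<in>T. \<epsilon>' N l * y l)"
      by (intro sum.cong refl) (auto simp: \<epsilon>'_def N_def)
    also have "\<dots> = inner (X + t *\<^sub>R E) (Zf (T, N))"
      unfolding Y Zf_def prod.case by (rule inner_expansion_signed[OF _ T(1) ouI ovI, symmetric]) auto
    also have "\<dots> \<le> s + t * \<tau>"
      using T by (intro b(2) t) (auto simp: \<J>_def N_def)
    finally show "inner (X + t *\<^sub>R E) Z \<le> s + t * \<tau>" .
  qed
  show ?thesis
  proof (intro exI[of _ "b / 2"] conjI ballI)
    show "(s + t * \<tau>, X + t *\<^sub>R E) \<in> kyfan_cone k" if "t \<in> {0..b / 2}" for t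
      using mem[of t] K b(1) that by (cases "t = 0") auto
  qed (use b in simp)
qed

text \<open>The truncated exponential of a skew matrix \<open>A\<close> replaces a curve of rotations: it is an isometry up
  to a factor \<open>1 + O(t\<^sup>4)\<close>.\<close>

definition second_order_rotation :: "real \<Rightarrow> real^'a^'a \<Rightarrow> real^'a^'a" where
  "second_order_rotation t A = mat 1 + t *\<^sub>R A + (t\<^sup>2 / 2) *\<^sub>R (A ** A)"

text \<open>Skewness makes \<open>A *v a\<close> orthogonal to both \<open>a\<close> and
  \<open>A *v (A *v a)\<close>, while the product of \<open>a\<close> with
  \<open>A *v (A *v a)\<close> cancels the square of the linear term. Only a quartic term
  survives.\<close>

lemma second_order_rotation_near_isometry:
  fixes A :: "real^'a^'a"
  assumes skew: "transpose A = - A"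
  shows "\<exists>c\<ge>0. \<forall>t a. inner (second_order_rotation t A *v a) (second_order_rotation t A *v a)
    \<le> (1 + c * t ^ 4) * inner a a"
proof -
  have adj: "inner (A *v a) b = - inner a (A *v b)" for a b
  proof -
    have "inner a (A *v b) = inner (transpose A *v a) b" by (simp add: dot_lmul_matrix)
    also have "\<dots> = - inner (A *v a) b"
      unfolding skew by (simp add: matrix_vector_mult_def inner_vec_def sum_negf)
    finally show ?thesis by simp
  qed
  have z: "inner a (A *v a) = 0" for a
    using adj[of a a] by (simp add: inner_commute)
  have "linear (\<lambda>a. A *v (A *v a))"
    by (auto intro!: linearI simp: matrix_vector_right_distrib matrix_vector_mult_scaleR)
  then obtain B where B: "\<And>a. norm (A *v (A *v a)) \<le> B * norm a"
    using linear_bounded by blast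
  have "inner (second_order_rotation t A *v a) (second_order_rotation t A *v a)
      \<le> (1 + B\<^sup>2 / 4 * t ^ 4) * inner a a" for t a
  proof -
    let ?b = "A *v a" and ?c = "A *v (A *v a)"
    have r: "second_order_rotation t A *v a = a + t *\<^sub>R ?b + (t\<^sup>2 / 2) *\<^sub>R ?c"
      by (simp add: second_order_rotation_def matrix_vector_mult_add_rdistrib
          scaleR_matrix_vector_assoc[symmetric] matrix_vector_mul_assoc)
    have e: "inner a ?b = 0" "inner ?b a = 0" "inner a ?c = - inner ?b ?b" "inner ?c a = - inner ?b ?b"
      "inner ?b ?c = 0" "inner ?c ?b = 0"
      using z[of a] z[of ?b] adj[of a ?b] by (simp_all add: inner_commute)
    have "inner (second_order_rotation t A *v a) (second_order_rotation t A *v a)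
        = inner a a + t ^ 4 / 4 * inner ?c ?c"
      unfolding r by (simp add: inner_add_left inner_add_right e algebra_simps power2_eq_square power4_eq_xxxx)
    also have "t ^ 4 / 4 * inner ?c ?c \<le> t ^ 4 / 4 * (B\<^sup>2 * inner a a)"
      using power_mono[OF B[of a], of 2]
      by (intro mult_left_mono) (simp_all add: power2_norm_eq_inner power_mult_distrib)
    finally show ?thesis by (simp add: algebra_simps)
  qed
  then show ?thesis by (intro exI[of _ "B\<^sup>2 / 4"]) auto
qed

text \<open>For skew \<open>A\<close> and \<open>B\<close>, the velocity at \<open>t = 0\<close> of
  \<open>(s, exp(tA) Y exp(tB)^T)\<close>; the minus sign stems from
  \<open>transpose B = - B\<close>, and the first component is 0 because rotations preserve the
  norm.\<close>

definition orbit_tangent :: "real^'m^'m \<Rightarrow> real^'n^'n \<Rightarrow> ('m::finite, 'n::finite) XX \<Rightarrow> ('m, 'n) XX" where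
  "orbit_tangent A B = (\<lambda>(s, Y). (0, A ** Y - Y ** B))"

lemma matrix_add_rdistrib: "(A + B) ** C = A ** C + B ** C" for A B :: "real^'n^'m"
  by (simp add: matrix_matrix_mult_def vec_eq_iff sum.distrib distrib_right)

lemma matrix_minus_left: "(- A) ** C = - (A ** C)" for A :: "real^'n^'m"
  by (simp add: matrix_matrix_mult_def vec_eq_iff sum_negf)

lemma matrix_minus_right: "C ** (- A) = - (C ** A)" for A :: "real^'n^'m"
  by (simp add: matrix_matrix_mult_def vec_eq_iff sum_negf)

lemma matrix_diff_left: "(A - B) ** C = A ** C - B ** C" for A B :: "real^'n^'m"
  by (simp add: matrix_matrix_mult_def vec_eq_iff sum_subtractf left_diff_distrib)

lemma matrix_diff_right: "C ** (A - B) = C ** A - C ** B" for A B :: "real^'n^'m"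
  by (simp add: matrix_matrix_mult_def vec_eq_iff sum_subtractf right_diff_distrib)

lemmas matrix_mult_bilinear = matrix_diff_left matrix_diff_right matrix_add_rdistrib matrix_add_ldistrib matrix_minus_left
  matrix_minus_right scalar_matrix_assoc[symmetric] matrix_scalar_ac

lemma transpose_add: "transpose (A + B) = transpose A + transpose B" for A B :: "real^'n^'m"
  by (simp add: transpose_def vec_eq_iff)

lemma transpose_scaleR: "transpose (c *\<^sub>R A) = c *\<^sub>R transpose A" for A :: "real^'n^'m"
  by (simp add: transpose_def vec_eq_iff)

lemma transpose_zero: "transpose 0 = (0 :: real^'n^'m)"
  by (simp add: transpose_def vec_eq_iff)

lemma transpose_diff: "transpose (A - B) = transpose A - transpose B" for A B :: "real^'n^'m"
  by (simp add: transpose_def vec_eq_iff)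

lemma transpose_minus: "transpose (- A) = - transpose A" for A :: "real^'n^'m"
  by (simp add: transpose_def vec_eq_iff)

lemma linear_orbit_tangent: "linear (orbit_tangent A B)"
  by (rule linearI)
     (auto simp: orbit_tangent_def matrix_mult_bilinear scaleR_diff_right split: prod.splits)

text \<open>The comparison point \<open>Q'\<close> applies the truncated rotations to the matrix and
  multiplies the first component by \<open>?\<kappa>\<close>, which keeps it in the cone. It differs
  from the second-order flow by terms of order three and four with coefficients linear in
  \<open>Q\<close>, hence the factor \<open>1 + norm Q\<close>.\<close>

lemma kyfan_cone_near_rotation:
  fixes A :: "real^'m^'m" and B :: "real^'n^'n"
  assumes mn: "CARD('m) \<le> CARD('n)" and k: "k \<le> CARD('m)"
    and A: "transpose A = - A" and B: "transpose B = - B"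
  shows "\<exists>C\<ge>0. \<forall>Q\<in>kyfan_cone k. \<forall>t\<in>{-1..1}.
     infdist (Q + t *\<^sub>R orbit_tangent A B Q + (t\<^sup>2 / 2) *\<^sub>R orbit_tangent A B (orbit_tangent A B Q))
       (kyfan_cone k) \<le> C * \<bar>t\<bar> ^ 3 * (1 + norm Q)"
proof -
  obtain cA where cA: "0 \<le> cA" "\<And>t a. inner (second_order_rotation t A *v a) (second_order_rotation t A *v a)
    \<le> (1 + cA * t ^ 4) * inner a a"
    using second_order_rotation_near_isometry[OF A] by blast
  obtain cB where cB: "0 \<le> cB" "\<And>t a. inner (second_order_rotation t B *v a) (second_order_rotation t B *v a)
    \<le> (1 + cB * t ^ 4) * inner a a"
    using second_order_rotation_near_isometry[OF B] by blast
  define c where "c = cA + cB"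
  \<comment> \<open>\<open>R1\<close> and \<open>R2\<close> are the coefficients of
    \<open>t ^ 3\<close> and \<open>t ^ 4\<close> in the product of \<open>Y\<close> with the two
    truncated exponentials.\<close>
  define R1 where "R1 Y = (1/2) *\<^sub>R (A ** Y ** (B ** B) - (A ** A) ** Y ** B)" for Y :: "real^'n^'m"
  define R2 where "R2 Y = (1/4) *\<^sub>R ((A ** A) ** Y ** (B ** B))" for Y :: "real^'n^'m"
  have "linear R1" "linear R2"
    unfolding R1_def R2_def
    by (auto intro!: linearI simp: matrix_mult_bilinear scaleR_diff_right scaleR_add_right)
  then obtain b1 b2 where b: "\<And>Y. norm (R1 Y) \<le> b1 * norm Y" "\<And>Y. norm (R2 Y) \<le> b2 * norm Y"
    using linear_bounded by metis
  define C where "C = c + \<bar>b1\<bar> + \<bar>b2\<bar>"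
  have C: "0 \<le> C" using cA cB by (simp add: C_def c_def)
  have "infdist (Q + t *\<^sub>R orbit_tangent A B Q + (t\<^sup>2 / 2) *\<^sub>R orbit_tangent A B (orbit_tangent A B Q))
       (kyfan_cone k) \<le> C * \<bar>t\<bar> ^ 3 * (1 + norm Q)" if Q: "Q \<in> kyfan_cone k" and t: "t \<in> {-1..1}" for Q t
  proof -
    obtain s Y where sY: "Q = (s, Y)" by (cases Q)
    let ?M = "second_order_rotation t A" and ?N = "second_order_rotation t B"
    let ?\<kappa> = "1 + c * t ^ 4"
    define Q' where "Q' = (?\<kappa> * s, ?M ** Y ** transpose ?N)"
    have c: "0 \<le> c" using cA cB by (simp add: c_def)
    have t4: "0 \<le> t ^ 4" by simp
    have \<kappa>: "0 < ?\<kappa>" using c t4 by (meson add_pos_nonneg mult_nonneg_nonneg zero_less_one)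
    have bd: "inner (?M *v a) (?M *v a) \<le> ?\<kappa> * inner a a" for a
    proof -
      have "(1 + cA * t ^ 4) * inner a a \<le> ?\<kappa> * inner a a"
        using cB(1) t4 by (intro mult_right_mono add_left_mono) (auto simp: c_def)
      then show ?thesis using cA(2)[of t a] by linarith
    qed
    have bd': "inner (?N *v a) (?N *v a) \<le> ?\<kappa> * inner a a" for a
    proof -
      have "(1 + cB * t ^ 4) * inner a a \<le> ?\<kappa> * inner a a"
        using cA(1) t4 by (intro mult_right_mono add_left_mono) (auto simp: c_def)
      then show ?thesis using cB(2)[of t a] by linarith
    qed
    have Q': "Q' \<in> kyfan_cone k"
      unfolding Q'_def using kyfan_cone_mult[OF mn k \<kappa> bd bd'] Q unfolding sY by blast
    have tN: "transpose ?N = mat 1 - t *\<^sub>R B + (t\<^sup>2 / 2) *\<^sub>R (B ** B)"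
      by (simp add: second_order_rotation_def transpose_add transpose_scaleR matrix_transpose_mul B
          matrix_minus_left matrix_minus_right transpose_mat)
    have ex: "?M ** Y ** transpose ?N = Y + t *\<^sub>R (A ** Y - Y ** B)
       + (t\<^sup>2 / 2) *\<^sub>R (A ** (A ** Y - Y ** B) - (A ** Y - Y ** B) ** B) + t ^ 3 *\<^sub>R R1 Y + t ^ 4 *\<^sub>R R2 Y"
      unfolding tN unfolding second_order_rotation_def R1_def R2_def
      by (simp add: matrix_mult_bilinear matrix_mul_assoc algebra_simps power2_eq_square
          power3_eq_cube power4_eq_xxxx scaleR_2[symmetric])
    let ?P = "Q + t *\<^sub>R orbit_tangent A B Q + (t\<^sup>2 / 2) *\<^sub>R orbit_tangent A B (orbit_tangent A B Q)"
    have df: "Q' - ?P = (c * t ^ 4 * s, t ^ 3 *\<^sub>R R1 Y + t ^ 4 *\<^sub>R R2 Y)"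
      unfolding Q'_def ex by (simp add: sY orbit_tangent_def algebra_simps)
    have t43: "t ^ 4 \<le> \<bar>t\<bar> ^ 3"
    proof -
      have "\<bar>t\<bar> ^ 4 \<le> \<bar>t\<bar> ^ 3" using t by (intro power_decreasing) auto
      then show ?thesis by simp
    qed
    have nn: "norm s \<le> norm Q" "norm Y \<le> norm Q"
      unfolding sY by (rule norm_fst_le, rule norm_snd_le)
    have "infdist ?P (kyfan_cone k) \<le> dist ?P Q'" by (rule infdist_le[OF Q'])
    also have "\<dots> = norm (Q' - ?P)" by (simp add: dist_norm norm_minus_commute)
    also have "\<dots> \<le> norm (c * t ^ 4 * s) + norm (t ^ 3 *\<^sub>R R1 Y + t ^ 4 *\<^sub>R R2 Y)"
      unfolding df by (rule norm_Pair_le)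
    also have "\<dots> \<le> c * t ^ 4 * norm s + (\<bar>t\<bar> ^ 3 * norm (R1 Y) + t ^ 4 * norm (R2 Y))"
      using norm_triangle_ineq[of "t ^ 3 *\<^sub>R R1 Y" "t ^ 4 *\<^sub>R R2 Y"] c
      by (simp add: abs_mult power_abs)
    also have "\<dots> \<le> c * \<bar>t\<bar> ^ 3 * norm Q + (\<bar>t\<bar> ^ 3 * (\<bar>b1\<bar> * norm Q) + \<bar>t\<bar> ^ 3 * (\<bar>b2\<bar> * norm Q))"
    proof -
      have "norm (R1 Y) \<le> \<bar>b1\<bar> * norm Q"
        using b(1)[of Y] nn(2) by (meson abs_ge_self abs_ge_zero mult_mono norm_ge_zero order_trans)
      moreover have "norm (R2 Y) \<le> \<bar>b2\<bar> * norm Q"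
        using b(2)[of Y] nn(2) by (meson abs_ge_self abs_ge_zero mult_mono norm_ge_zero order_trans)
      ultimately show ?thesis
        using t43 nn(1) c by (intro add_mono mult_mono mult_left_mono) auto
    qed
    also have "\<dots> = C * \<bar>t\<bar> ^ 3 * norm Q" by (simp add: C_def algebra_simps)
    also have "\<dots> \<le> C * \<bar>t\<bar> ^ 3 * (1 + norm Q)" using C by (intro mult_left_mono) auto
    finally show ?thesis .
  qed
  then show ?thesis using C by blast
qed

text \<open>Splitting off the tangent space of the orbit of \<open>X\<close> under \<open>O(m) \<times> O(n)\<close>: its orthogonal
  complement consists of the matrices that admit a singular value decomposition with the same
  singular vectors as \<open>X\<close> (up to signs of the singular values).\<close>

lemma orbit_tangent_decomposition:
  fixes X D :: "real^'n^'m"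
  obtains A :: "real^'m^'m" and B :: "real^'n^'n" and E :: "real^'n^'m"
  where "transpose A = - A" "transpose B = - B" "D = E + (A ** X - X ** B)"
    "E ** transpose X = X ** transpose E" "transpose X ** E = transpose E ** X"
proof -
  define S where "S = {A ** X - X ** B | A B. transpose A = - A \<and> transpose B = - B}"
  have subS: "subspace S"
    unfolding subspace_def
  proof (intro conjI ballI allI)
    show "0 \<in> S" unfolding S_def
      by (rule CollectI, rule exI[of _ 0], rule exI[of _ 0]) (simp add: transpose_def vec_eq_iff)
    fix P Q assume "P \<in> S" "Q \<in> S"
    then obtain A B A' B' where "P = A ** X - X ** B" "Q = A' ** X - X ** B'"
      "transpose A = - A" "transpose B = - B" "transpose A' = - A'" "transpose B' = - B'"
      unfolding S_def by blast
    then show "P + Q \<in> S" unfolding S_def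
      by (intro CollectI exI[of _ "A + A'"] exI[of _ "B + B'"]) (simp add: matrix_mult_bilinear transpose_add)
  next
    fix r P assume "P \<in> S"
    then obtain A B where "P = A ** X - X ** B" "transpose A = - A" "transpose B = - B"
      unfolding S_def by blast
    then show "r *\<^sub>R P \<in> S" unfolding S_def
      by (intro CollectI exI[of _ "r *\<^sub>R A"] exI[of _ "r *\<^sub>R B"])
         (simp add: matrix_mult_bilinear transpose_scaleR scaleR_diff_right)
  qed
  obtain P E where PE: "P \<in> span S" "\<And>w. w \<in> span S \<Longrightarrow> orthogonal E w" "D = P + E"
    using orthogonal_subspace_decomp_exists[of S D] by metis
  have spanS: "span S = S" using subS by (simp add: span_eq_iff)
  obtain A B where AB: "P = A ** X - X ** B" "transpose A = - A" "transpose B = - B"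
    using PE(1) unfolding spanS unfolding S_def by blast
  \<comment> \<open>The defects of the two symmetry relations are themselves skew, hence admissible
    generators. Orthogonality of \<open>E\<close> to the orbit directions they generate makes their
    own norms vanish.\<close>
  define A' where "A' = E ** transpose X - X ** transpose E"
  define B' where "B' = transpose X ** E - transpose E ** X"
  have sk: "transpose A' = - A'" "transpose B' = - B'"
    unfolding A'_def B'_def by (simp_all add: transpose_diff matrix_transpose_mul)
  have "A' ** X - X ** 0 \<in> S"
    unfolding S_def using sk by (intro CollectI exI[of _ A'] exI[of _ 0]) (simp add: transpose_zero)
  moreover have "0 ** X - X ** (- B') \<in> S"
    unfolding S_def using sk
    by (intro CollectI exI[of _ 0] exI[of _ "- B'"]) (simp add: transpose_zero transpose_minus)
  ultimately have "orthogonal E (A' ** X - X ** 0)" "orthogonal E (0 ** X - X ** (- B'))"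
    using PE(2) unfolding spanS by blast+
  then have "orthogonal E (A' ** X)" "orthogonal E (X ** B')"
    by (simp_all add: matrix_minus_right)
  then have o: "inner A' (E ** transpose X) = 0" "inner B' (transpose X ** E) = 0"
    by (simp_all add: orthogonal_def inner_commute[of E] inner_matrix_mult_left inner_matrix_mult_right)
  have "inner A' (X ** transpose E) = inner (transpose A') (transpose (X ** transpose E))"
    by (simp add: inner_transpose)
  also have "\<dots> = - inner A' (E ** transpose X)"
    by (simp add: sk matrix_transpose_mul)
  finally have "inner A' A' = 0"
    using o(1) by (subst (2) A'_def) (simp add: inner_diff_right)
  moreover have "inner B' (transpose E ** X) = inner (transpose B') (transpose (transpose E ** X))"
    by (simp add: inner_transpose)
  then have "inner B' (transpose E ** X) = - inner B' (transpose X ** E)"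
    by (simp add: sk matrix_transpose_mul)
  then have "inner B' B' = 0"
    using o(2) by (subst (2) B'_def) (simp add: inner_diff_right)
  ultimately have "A' = 0" "B' = 0" by simp_all
  then show ?thesis
    using AB PE(3) by (intro that[of A B E]) (auto simp: A'_def B'_def)
qed

lemma orbit_regular_kyfan_cone:
  assumes mn: "CARD('m) \<le> CARD('n)" and k: "k \<le> CARD('m)"
  shows "orbit_regular (kyfan_cone k :: ('m::finite, 'n::finite) XX set)"
  unfolding orbit_regular_def
proof (intro ballI)
  let ?K = "kyfan_cone k :: ('m, 'n) XX set"
  fix P d assume P: "P \<in> ?K" and d: "d \<in> tangent_cone ?K P"
  obtain s X where sX: "P = (s, X)" by (cases P)
  obtain \<tau> D where \<tau>D: "d = (\<tau>, D)" by (cases d)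
  obtain A :: "real^'m^'m" and B :: "real^'n^'n" and E where
    A: "transpose A = - A" and B: "transpose B = - B" and D: "D = E + (A ** X - X ** B)"
    and E: "E ** transpose X = X ** transpose E" "transpose X ** E = transpose E ** X"
    using orbit_tangent_decomposition[of D X] by blast
  let ?L = "orbit_tangent A B"
  obtain C where C: "0 \<le> C" and near: "\<And>Q t. Q \<in> ?K \<Longrightarrow> t \<in> {-1..1} \<Longrightarrow>
      infdist (Q + t *\<^sub>R ?L Q + (t\<^sup>2 / 2) *\<^sub>R ?L (?L Q)) ?K \<le> C * \<bar>t\<bar> ^ 3 * (1 + norm Q)"
    using kyfan_cone_near_rotation[OF mn k A B] by blast
  have de: "d = (\<tau>, E) + ?L P"
    by (simp add: \<tau>D sX D orbit_tangent_def)
  \<comment> \<open>An active \<open>Z\<close> gives the normal \<open>(- 1, Z)\<close>, which is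
    orthogonal to the orbit direction \<open>?L P\<close>. The inequality for the tangent
    \<open>d\<close> thus passes to its remaining part \<open>(\<tau>, E)\<close>.\<close>
  have act: "inner E Z \<le> \<tau>" if Z: "Z \<in> kyfan_dual k" "inner X Z = s" for Z
  proof -
    have N: "(- 1, Z) \<in> normal_cone ?K P"
      unfolding normal_cone_def sX
      using Z kyfan_cone_iff[OF mn k] by (auto simp: inner_diff_right inner_commute)
    have "inner (- 1, Z) (?L P) = 0"
      using near[OF P] C
      by (intro normal_cone_orthogonal_orbit[OF closed_kyfan_cone[OF mn k] P N, of _ "?L (?L P)" "C * (1 + norm P)"])
         (auto simp: algebra_simps)
    moreover have "inner (- 1, Z) d \<le> 0"
      by (rule normal_cone_inner_tangent_le_0[OF N d])
    ultimately have "inner (- 1, Z) (\<tau>, E) \<le> 0"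
      unfolding de by (simp add: inner_add_right)
    then show ?thesis by (simp add: inner_commute)
  qed
  have c1: "X *v (a v* E) = E *v (a v* X)" for a
    using E(1) by (metis matrix_vector_mul_assoc transpose_matrix_vector)
  have c2: "(E *v b) v* X = (X *v b) v* E" for b
    using E(2) by (metis matrix_vector_mul_assoc transpose_matrix_vector)
  have "\<exists>\<epsilon>>0. \<forall>t\<in>{0..\<epsilon>}. (s + t * \<tau>, X + t *\<^sub>R E) \<in> ?K"
    by (rule simultaneous_SVD[OF mn c1 c2]) (rule kyfan_cone_ray[OF mn k _ _ _ _ P[unfolded sX] act])
  then obtain \<epsilon> where \<epsilon>: "0 < \<epsilon>" "\<And>t. t \<in> {0..\<epsilon>} \<Longrightarrow> (s + t * \<tau>, X + t *\<^sub>R E) \<in> ?K"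
    by blast
  have "bounded_linear ?L"
    using linear_orbit_tangent linear_conv_bounded_linear by blast
  moreover have "\<forall>t\<in>{0..\<epsilon>}. P + t *\<^sub>R (\<tau>, E) \<in> ?K"
    using \<epsilon>(2) by (simp add: sX)
  ultimately show "\<exists>L e C \<epsilon>. bounded_linear L \<and> d = e + L P \<and> 0 < \<epsilon> \<and> 0 \<le> C \<and>
     (\<forall>t\<in>{0..\<epsilon>}. P + t *\<^sub>R e \<in> ?K) \<and>
     (\<forall>Q\<in>?K. \<forall>t\<in>{-1..1}. infdist (Q + t *\<^sub>R L Q + (t\<^sup>2 / 2) *\<^sub>R L (L Q)) ?K
                             \<le> C * \<bar>t\<bar> ^ 3 * (1 + norm Q))"
    using de \<epsilon>(1) C near
    by (intro exI[of _ ?L] exI[of _ "(\<tau>, E)"] exI[of _ C] exI[of _ \<epsilon>]) blast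
qed

section \<open>Perturbed KKT systems\<close>

text \<open>Hadamard form of the derivative: the direction may vary with the step, as normalised
  differences of solutions do.\<close>

lemma has_derivative_sequential:
  fixes F :: "'a::real_normed_vector \<Rightarrow> 'b::real_normed_vector"
  assumes F: "(F has_derivative F') (at x)"
    and t: "\<And>j::nat. 0 < t j" "t \<longlonglongrightarrow> 0" and \<xi>: "\<xi> \<longlonglongrightarrow> z"
  shows "(\<lambda>j. (1 / t j) *\<^sub>R (F (x + t j *\<^sub>R \<xi> j) - F x)) \<longlonglongrightarrow> F' z"
proof -
  interpret F': bounded_linear F' using F by (rule has_derivative_bounded_linear)
  define R where "R j = (1 / t j) *\<^sub>R (F (x + t j *\<^sub>R \<xi> j) - F x) - F' (\<xi> j)" for j
  have "R \<longlonglongrightarrow> 0"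
  proof (rule tendstoI)
    fix e :: real assume e: "0 < e"
    define e' where "e' = e / (norm z + 1)"
    have e': "0 < e'" using e by (simp add: e'_def add_nonneg_pos)
    obtain d where d: "0 < d" "\<And>y. norm (y - x) < d \<Longrightarrow> norm (F y - F x - F' (y - x)) \<le> e' * norm (y - x)"
      using F e' unfolding has_derivative_at_alt by blast
    have "(\<lambda>j. norm (t j *\<^sub>R \<xi> j)) \<longlonglongrightarrow> norm (0 *\<^sub>R z)" by (intro tendsto_intros t \<xi>)
    then have ev1: "eventually (\<lambda>j. norm (t j *\<^sub>R \<xi> j) < d) sequentially"
      using d(1) by (intro order_tendstoD(2)) auto
    have "(\<lambda>j. norm (\<xi> j)) \<longlonglongrightarrow> norm z" by (intro tendsto_intros \<xi>)
    then have ev2: "eventually (\<lambda>j. norm (\<xi> j) < norm z + 1) sequentially"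
      by (rule order_tendstoD(2)) simp
    show "eventually (\<lambda>j. dist (R j) 0 < e) sequentially"
      using ev1 ev2
    proof eventually_elim
      case (elim j)
      have "R j = (1 / t j) *\<^sub>R (F (x + t j *\<^sub>R \<xi> j) - F x - F' (t j *\<^sub>R \<xi> j))"
        using t(1)[of j] by (simp add: R_def F'.scaleR scaleR_diff_right)
      then have "norm (R j) = (1 / t j) * norm (F (x + t j *\<^sub>R \<xi> j) - F x - F' (t j *\<^sub>R \<xi> j))"
        using t(1)[of j] by simp
      also have "\<dots> \<le> (1 / t j) * (e' * norm (t j *\<^sub>R \<xi> j))"
        using d(2)[of "x + t j *\<^sub>R \<xi> j"] elim(1) t(1)[of j] by (intro mult_left_mono) auto
      also have "\<dots> = e' * norm (\<xi> j)" using t(1)[of j] by simp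
      also have "\<dots> < e' * (norm z + 1)" using e' elim(2) by simp
      also have "\<dots> = e" unfolding e'_def using add_nonneg_pos[OF norm_ge_zero[of z] zero_less_one] by simp
      finally show ?case by simp
    qed
  qed
  moreover have "(\<lambda>j. F' (\<xi> j)) \<longlonglongrightarrow> F' z" by (rule F'.tendsto[OF \<xi>])
  ultimately have "(\<lambda>j. R j + F' (\<xi> j)) \<longlonglongrightarrow> 0 + F' z" by (rule tendsto_add)
  then show ?thesis by (simp add: R_def)
qed

lemma inner_lag_grad:
  "inner (lag_grad f1 h1 G1 x lam Y) v
     = blinfun_apply (f1 x) v + inner lam (blinfun_apply (h1 x) v) + inner Y (blinfun_apply (G1 x) v)"
proof -
  define \<phi> where "\<phi> v = blinfun_apply (f1 x) v + inner lam (blinfun_apply (h1 x) v)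
    + inner Y (blinfun_apply (G1 x) v)" for v
  have lin: "linear \<phi>"
    unfolding \<phi>_def
    by (rule linearI) (auto simp: blinfun.add_right blinfun.scaleR_right inner_add_right algebra_simps)
  have "\<phi> v = \<phi> (\<Sum>b\<in>Basis. inner v b *\<^sub>R b)" by (simp add: euclidean_representation)
  also have "\<dots> = (\<Sum>b\<in>Basis. inner v b * \<phi> b)"
    by (simp add: linear_sum[OF lin] linear_cmul[OF lin])
  also have "\<dots> = inner (lag_grad f1 h1 G1 x lam Y) v"
    unfolding lag_grad_def \<phi>_def by (simp add: inner_sum_left inner_commute[of v] mult.commute)
  finally show ?thesis by (simp add: \<phi>_def)
qed

text \<open>The linearised perturbed KKT system has only the trivial solution: the second-order condition
  kills the primal direction, then the strict constraint qualification the dual one.\<close>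

lemma linearized_KKT_trivial:
  fixes K :: "'a::euclidean_space set" and h :: "'a \<Rightarrow> 'p::euclidean_space"
  assumes K: "closed K" "orbit_regular K"
    and f2: "(f1 has_derivative blinfun_apply (f2 xb)) (at xb)"
    and h1: "(h has_derivative blinfun_apply (h1 xb)) (at xb)"
    and h2: "(h1 has_derivative blinfun_apply (h2 xb)) (at xb)"
    and G1: "(G has_derivative blinfun_apply (G1 xb)) (at xb)"
    and G2: "(G1 has_derivative blinfun_apply (G2 xb)) (at xb)"
    and feas: "h xb = 0" "G xb \<in> K"
    and mult: "(lb, Yb) \<in> multipliers K f1 h1 G1 G xb"
    and SOSC: "\<And>Z w. Z \<in> critical_cone K f1 h1 G1 G xb \<Longrightarrow> Z \<noteq> 0 \<Longrightarrow>
        w \<in> second_tangent_set K (G xb) (blinfun_apply (G1 xb) Z) \<Longrightarrow>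
        inner Yb w < lag_hess_quad f2 h2 G2 xb lb Yb Z"
    and SRCQ: "{(blinfun_apply (h1 xb) Z, blinfun_apply (G1 xb) Z + W) | Z W.
                 W \<in> tangent_cone K (G xb) \<inter> {W. inner W Yb = 0}} = UNIV"
    and t: "\<And>j::nat. 0 < t j" "t \<longlonglongrightarrow> 0"
    and dir: "\<xi> \<longlonglongrightarrow> Z" "la \<longlonglongrightarrow> l" "yy \<longlonglongrightarrow> y"
    and rg: "(\<lambda>j. (1 / t j) *\<^sub>R lag_grad f1 h1 G1 (xb + t j *\<^sub>R \<xi> j) (lb + t j *\<^sub>R la j) (Yb + t j *\<^sub>R yy j)) \<longlonglongrightarrow> 0"
    and rh: "(\<lambda>j. (1 / t j) *\<^sub>R h (xb + t j *\<^sub>R \<xi> j)) \<longlonglongrightarrow> 0"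
    and c: "(\<lambda>j. (1 / t j) *\<^sub>R c1 j) \<longlonglongrightarrow> 0" "(\<lambda>j. (1 / t j) *\<^sub>R c2 j) \<longlonglongrightarrow> 0"
    and PK: "\<And>j. G (xb + t j *\<^sub>R \<xi> j) - c1 j \<in> K"
    and N: "\<And>j. Yb + t j *\<^sub>R yy j + c2 j \<in> normal_cone K (G (xb + t j *\<^sub>R \<xi> j) - c1 j)"
  shows "Z = 0" "l = 0" "y = 0"
proof -
  let ?x = "\<lambda>j. xb + t j *\<^sub>R \<xi> j"
  have gr0: "lag_grad f1 h1 G1 xb lb Yb = 0" and Yb: "Yb \<in> normal_cone K (G xb)"
    using mult unfolding multipliers_def by auto
  have xlim: "?x \<longlonglongrightarrow> xb"
  proof -
    have "?x \<longlonglongrightarrow> xb + 0 *\<^sub>R Z" by (intro tendsto_intros t dir)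
    then show ?thesis by simp
  qed
  have hZ: "blinfun_apply (h1 xb) Z = 0"
  proof -
    have "(\<lambda>j. (1 / t j) *\<^sub>R (h (?x j) - h xb)) \<longlonglongrightarrow> blinfun_apply (h1 xb) Z"
      by (rule has_derivative_sequential[OF h1 t dir(1)])
    then show ?thesis using rh feas(1) LIMSEQ_unique by auto
  qed
  define d where "d = blinfun_apply (G1 xb) Z"
  \<comment> \<open>The residuals \<open>c1\<close> and \<open>c2\<close> are of smaller order than
    \<open>t\<close>. Absorbed into the directions, they leave the limits unchanged and turn the
    inclusion into the form required by the graphical derivative.\<close>
  define dd where "dd j = (1 / t j) *\<^sub>R (G (?x j) - G xb) - (1 / t j) *\<^sub>R c1 j" for j
  define yy' where "yy' j = yy j + (1 / t j) *\<^sub>R c2 j" for j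
  have dd: "dd \<longlonglongrightarrow> d"
    using tendsto_diff[OF has_derivative_sequential[OF G1 t dir(1)] c(1)] by (simp add: dd_def[abs_def] d_def)
  have yy': "yy' \<longlonglongrightarrow> y"
    using tendsto_add[OF dir(3) c(2)] by (simp add: yy'_def[abs_def])
  have Pe: "G xb + t j *\<^sub>R dd j = G (?x j) - c1 j" "Yb + t j *\<^sub>R yy' j = Yb + t j *\<^sub>R yy j + c2 j" for j
    using t(1)[of j] by (simp_all add: dd_def yy'_def scaleR_diff_right scaleR_add_right)
  have PK': "G xb + t j *\<^sub>R dd j \<in> K" for j using PK Pe by simp
  have N': "Yb + t j *\<^sub>R yy' j \<in> normal_cone K (G xb + t j *\<^sub>R dd j)" for j
    using N[of j] unfolding Pe .
  have lin: "blinfun_apply (blinfun_apply (f2 xb) Z) v + inner lb (blinfun_apply (blinfun_apply (h2 xb) Z) v)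
      + inner l (blinfun_apply (h1 xb) v) + inner Yb (blinfun_apply (blinfun_apply (G2 xb) Z) v)
      + inner y (blinfun_apply (G1 xb) v) = 0" for v
  proof -
    let ?q = "\<lambda>j. (1 / t j) *\<^sub>R lag_grad f1 h1 G1 (?x j) (lb + t j *\<^sub>R la j) (Yb + t j *\<^sub>R yy j)"
    have "(\<lambda>j. inner (?q j) v) \<longlonglongrightarrow> inner 0 v" by (intro tendsto_intros rg)
    then have lim0: "(\<lambda>j. inner (?q j) v) \<longlonglongrightarrow> 0" by simp
    have gv: "blinfun_apply (f1 xb) v + inner lb (blinfun_apply (h1 xb) v) + inner Yb (blinfun_apply (G1 xb) v) = 0"
      using inner_lag_grad[of f1 h1 G1 xb lb Yb v] gr0 by simp
    \<comment> \<open>The vanishing gradient at the reference point is subtracted and each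
      multiplier is split into reference value and increment, so that only difference quotients of
      derivatives and convergent factors remain.\<close>
    have eq: "inner (?q j) v = blinfun_apply ((1 / t j) *\<^sub>R (f1 (?x j) - f1 xb)) v
        + inner lb (blinfun_apply ((1 / t j) *\<^sub>R (h1 (?x j) - h1 xb)) v) + inner (la j) (blinfun_apply (h1 (?x j)) v)
        + inner Yb (blinfun_apply ((1 / t j) *\<^sub>R (G1 (?x j) - G1 xb)) v) + inner (yy j) (blinfun_apply (G1 (?x j)) v)"
      (is "_ = ?r j") for j
    proof -
      have tj: "0 < t j" by (rule t)
      have "?r j = inner (?q j) v - (1 / t j) * (blinfun_apply (f1 xb) v + inner lb (blinfun_apply (h1 xb) v)
          + inner Yb (blinfun_apply (G1 xb) v))"
        using tj by (simp add: inner_lag_grad blinfun.scaleR_left blinfun.diff_left inner_diff_right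
            inner_add_left field_simps)
      then show ?thesis unfolding gv by simp
    qed
    have h1c: "(\<lambda>j. h1 (?x j)) \<longlonglongrightarrow> h1 xb"
      by (rule isCont_tendsto_compose[OF has_derivative_continuous[OF h2] xlim])
    have G1c: "(\<lambda>j. G1 (?x j)) \<longlonglongrightarrow> G1 xb"
      by (rule isCont_tendsto_compose[OF has_derivative_continuous[OF G2] xlim])
    note ap = bounded_bilinear.tendsto[OF bounded_bilinear_blinfun_apply _ tendsto_const]
    have "(\<lambda>j. inner (?q j) v) \<longlonglongrightarrow> blinfun_apply (blinfun_apply (f2 xb) Z) v
      + inner lb (blinfun_apply (blinfun_apply (h2 xb) Z) v)
      + inner l (blinfun_apply (h1 xb) v) + inner Yb (blinfun_apply (blinfun_apply (G2 xb) Z) v)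
      + inner y (blinfun_apply (G1 xb) v)"
      unfolding eq
      by (intro tendsto_add tendsto_inner tendsto_const ap dir h1c G1c
          has_derivative_sequential[OF f2 t dir(1)] has_derivative_sequential[OF h2 t dir(1)]
          has_derivative_sequential[OF G2 t dir(1)])
    then show ?thesis using lim0 LIMSEQ_unique by blast
  qed
  show Z0: "Z = 0"
  proof (rule ccontr)
    assume Z: "Z \<noteq> 0"
    have Yd: "inner Yb d = 0"
      by (rule normal_cone_limit_inner_zero[OF feas(2) Yb t dd yy' PK' N'])
    have "d \<in> tangent_cone K (G xb)"
      unfolding tangent_cone_def using t dd PK' by blast
    moreover have "blinfun_apply (f1 xb) Z = 0"
      using inner_lag_grad[of f1 h1 G1 xb lb Yb Z] gr0 hZ Yd by (simp add: d_def)
    ultimately have crit: "Z \<in> critical_cone K f1 h1 G1 G xb"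
      unfolding critical_cone_def using hZ by (simp add: d_def)
    obtain w where w: "w \<in> second_tangent_set K (G xb) d" "- inner Yb w \<le> inner y d"
      using orbit_regular_graphical_derivative[OF K feas(2) Yb t dd yy' PK' N'] by blast
    have "inner Yb w < lag_hess_quad f2 h2 G2 xb lb Yb Z"
      using SOSC[OF crit Z] w(1) by (simp add: d_def)
    moreover have "lag_hess_quad f2 h2 G2 xb lb Yb Z = - inner y d"
      using lin[of Z] hZ by (simp add: lag_hess_quad_def d_def)
    ultimately show False using w(2) by simp
  qed
  then have d0: "dd \<longlonglongrightarrow> 0" using dd by (simp add: d_def)
  \<comment> \<open>The constraint qualification is applied to the dual direction itself. As
    \<open>Z = 0\<close>, linearised stationarity annihilates the part of \<open>(l, y)\<close>
    coming from the derivatives, and the product of \<open>y\<close> with \<open>W\<close> is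
    nonpositive; so the squared norm of \<open>(l, y)\<close> is nonpositive.\<close>
  have "(l, y) \<in> {(blinfun_apply (h1 xb) Z, blinfun_apply (G1 xb) Z + W) | Z W.
                 W \<in> tangent_cone K (G xb) \<inter> {W. inner W Yb = 0}}"
    unfolding SRCQ by simp
  then obtain v W where vW: "l = blinfun_apply (h1 xb) v" "y = blinfun_apply (G1 xb) v + W"
    "W \<in> tangent_cone K (G xb)" "inner Yb W = 0"
    by (auto simp: inner_commute)
  have "inner y W \<le> 0"
    by (rule orbit_regular_graphical_derivative_at_0[OF K feas(2) Yb t d0 yy' PK' N' vW(3,4)])
  moreover have "inner l (blinfun_apply (h1 xb) v) + inner y (blinfun_apply (G1 xb) v) = 0"
    using lin[of v] Z0 by simp
  moreover have "inner y y = inner y (blinfun_apply (G1 xb) v) + inner y W"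
    by (subst (2) vW(2)) (simp add: inner_add_right)
  ultimately have "inner l l + inner y y \<le> 0" using vW(1) by simp
  then have "inner l l = 0" "inner y y = 0"
    using inner_ge_zero[of l] inner_ge_zero[of y] by linarith+
  then show "l = 0" "y = 0" by simp_all
qed

lemma tendsto_scaled_null:
  fixes g :: "nat \<Rightarrow> 'b::real_normed_vector"
  assumes T: "\<And>j. 0 < T j" and lim: "(\<lambda>j. r j / T j) \<longlonglongrightarrow> 0" and g: "\<And>j. norm (g j) \<le> r j"
  shows "(\<lambda>j. (1 / T j) *\<^sub>R g j) \<longlonglongrightarrow> 0"
proof (rule Lim_null_comparison[OF always_eventually lim], rule allI)
  fix j
  show "norm ((1 / T j) *\<^sub>R g j) \<le> r j / T j"
    using divide_right_mono[OF g[of j], of "T j"] T[of j] by simp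
qed

text \<open>\<open>c1\<close> shifts the constraint value and \<open>c2\<close> the multiplier, so
  that one estimate covers both perturbed systems.\<close>

lemma KKT_error_bound:
  fixes K :: "'a::euclidean_space set" and h :: "'a \<Rightarrow> 'p::euclidean_space"
  assumes K: "closed K" "orbit_regular K"
    and f2: "(f1 has_derivative blinfun_apply (f2 xb)) (at xb)"
    and h1: "(h has_derivative blinfun_apply (h1 xb)) (at xb)"
    and h2: "(h1 has_derivative blinfun_apply (h2 xb)) (at xb)"
    and G1: "(G has_derivative blinfun_apply (G1 xb)) (at xb)"
    and G2: "(G1 has_derivative blinfun_apply (G2 xb)) (at xb)"
    and feas: "h xb = 0" "G xb \<in> K"
    and mult: "(lb, Yb) \<in> multipliers K f1 h1 G1 G xb"
    and SOSC: "\<And>Z w. Z \<in> critical_cone K f1 h1 G1 G xb \<Longrightarrow> Z \<noteq> 0 \<Longrightarrow>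
        w \<in> second_tangent_set K (G xb) (blinfun_apply (G1 xb) Z) \<Longrightarrow>
        inner Yb w < lag_hess_quad f2 h2 G2 xb lb Yb Z"
    and SRCQ: "{(blinfun_apply (h1 xb) Z, blinfun_apply (G1 xb) Z + W) | Z W.
                 W \<in> tangent_cone K (G xb) \<inter> {W. inner W Yb = 0}} = UNIV"
  shows "\<exists>\<epsilon>>0. \<exists>\<mu>\<ge>0. \<forall>x lam Y c1 c2. dist (x, lam, Y) (xb, lb, Yb) < \<epsilon> \<longrightarrow> G x - c1 \<in> K \<longrightarrow>
     Y + c2 \<in> normal_cone K (G x - c1) \<longrightarrow>
     dist (x, lam, Y) (xb, lb, Yb) \<le> \<mu> * (norm (lag_grad f1 h1 G1 x lam Y) + norm (h x) + norm c1 + norm c2)"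
proof (rule ccontr)
  define res where "res = (\<lambda>x lam Y (c1 :: 'a) (c2 :: 'a). norm (lag_grad f1 h1 G1 x lam Y) + norm (h x) + norm c1 + norm c2)"
  define zb where "zb = (xb, lb, Yb)"
  assume contra: "\<not> ?thesis"
  have neg: "\<exists>x lam Y c1 c2. dist (x, lam, Y) zb < \<epsilon> \<and> G x - c1 \<in> K \<and>
     Y + c2 \<in> normal_cone K (G x - c1) \<and> \<mu> * res x lam Y c1 c2 < dist (x, lam, Y) zb"
    if "0 < \<epsilon>" "0 \<le> \<mu>" for \<epsilon> \<mu>
  proof (rule ccontr)
    assume "\<not> (\<exists>x lam Y c1 c2. dist (x, lam, Y) zb < \<epsilon> \<and> G x - c1 \<in> K \<and>
     Y + c2 \<in> normal_cone K (G x - c1) \<and> \<mu> * res x lam Y c1 c2 < dist (x, lam, Y) zb)"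
    then have "\<forall>x lam Y c1 c2. dist (x, lam, Y) zb < \<epsilon> \<longrightarrow> G x - c1 \<in> K \<longrightarrow>
     Y + c2 \<in> normal_cone K (G x - c1) \<longrightarrow> dist (x, lam, Y) zb \<le> \<mu> * res x lam Y c1 c2"
      by (meson not_less)
    then show False using contra that unfolding res_def zb_def by blast
  qed
  \<comment> \<open>The radius \<open>1 / (real n + 1)\<close> forces the distances to 0, and the
    constant \<open>real n + 1\<close> makes the residual negligible relative to the
    distance.\<close>
  have "\<forall>n. \<exists>q. case q of (x, lam, Y, c1, c2) \<Rightarrow> dist (x, lam, Y) zb < 1 / (real n + 1) \<and> G x - c1 \<in> K \<and>
     Y + c2 \<in> normal_cone K (G x - c1) \<and> (real n + 1) * res x lam Y c1 c2 < dist (x, lam, Y) zb"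
  proof
    fix n :: nat
    show "\<exists>q. case q of (x, lam, Y, c1, c2) \<Rightarrow> dist (x, lam, Y) zb < 1 / (real n + 1) \<and> G x - c1 \<in> K \<and>
     Y + c2 \<in> normal_cone K (G x - c1) \<and> (real n + 1) * res x lam Y c1 c2 < dist (x, lam, Y) zb"
      using neg[of "1 / (real n + 1)" "real n + 1"] by auto
  qed
  from choice[OF this] obtain q where q: "\<forall>n. case q n of (x, lam, Y, c1, c2) \<Rightarrow> dist (x, lam, Y) zb < 1 / (real n + 1) \<and> G x - c1 \<in> K \<and>
     Y + c2 \<in> normal_cone K (G x - c1) \<and> (real n + 1) * res x lam Y c1 c2 < dist (x, lam, Y) zb"
    ..
  define x where "x n = fst (q n)" for n
  define lam where "lam n = fst (snd (q n))" for n
  define Y where "Y n = fst (snd (snd (q n)))" for n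
  define c1 where "c1 n = fst (snd (snd (snd (q n))))" for n
  define c2 where "c2 n = snd (snd (snd (snd (q n))))" for n
  define z where "z n = (x n, lam n, Y n)" for n
  define t where "t n = dist (z n) zb" for n
  define r where "r n = res (x n) (lam n) (Y n) (c1 n) (c2 n)" for n
  have Q: "t n < 1 / (real n + 1)" "G (x n) - c1 n \<in> K" "Y n + c2 n \<in> normal_cone K (G (x n) - c1 n)"
    "(real n + 1) * r n < t n" for n
    using spec[OF q, of n] unfolding t_def z_def r_def x_def lam_def Y_def c1_def c2_def
    by (auto split: prod.splits)
  have r0: "0 \<le> r n" for n by (simp add: r_def res_def)
  have tpos: "0 < t n" for n
    using Q(4)[of n] r0[of n] mult_nonneg_nonneg[of "real n + 1" "r n"] by linarith
  have inv0: "(\<lambda>n. 1 / (real n + 1)) \<longlonglongrightarrow> 0"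
    using LIMSEQ_inverse_real_of_nat by (simp add: inverse_eq_divide add.commute)
  have tlim: "t \<longlonglongrightarrow> 0"
    by (rule tendsto_sandwich[OF _ _ tendsto_const inv0])
       (use Q(1) tpos in \<open>auto intro!: always_eventually less_imp_le\<close>)
  have rle: "r n / t n \<le> 1 / (real n + 1)" for n
    using Q(4)[of n] tpos[of n] by (simp add: field_simps)
  have rlim: "(\<lambda>n. r n / t n) \<longlonglongrightarrow> 0"
    by (rule tendsto_sandwich[OF _ _ tendsto_const inv0])
       (use rle r0 tpos in \<open>auto intro!: always_eventually divide_nonneg_pos\<close>)
  define \<zeta> where "\<zeta> n = (1 / t n) *\<^sub>R (z n - zb)" for n
  have "\<zeta> n \<in> sphere 0 1" for n
    using tpos[of n] unfolding \<zeta>_def t_def by (simp add: dist_norm)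
  then obtain \<zeta>0 s where \<zeta>0: "\<zeta>0 \<in> sphere 0 1" and s: "strict_mono s" and lim: "(\<zeta> \<circ> s) \<longlonglongrightarrow> \<zeta>0"
    using compact_sphere[of "0 :: 'a \<times> 'p \<times> 'a" 1] unfolding compact_def by blast
  obtain Z l y where Zly: "\<zeta>0 = (Z, l, y)" by (cases \<zeta>0)
  define \<xi> where "\<xi> j = fst (\<zeta> (s j))" for j
  define la where "la j = fst (snd (\<zeta> (s j)))" for j
  define yy where "yy j = snd (snd (\<zeta> (s j)))" for j
  define T where "T j = t (s j)" for j
  have dir: "\<xi> \<longlonglongrightarrow> Z" "la \<longlonglongrightarrow> l" "yy \<longlonglongrightarrow> y"
    using tendsto_fst[OF lim] tendsto_fst[OF tendsto_snd[OF lim]] tendsto_snd[OF tendsto_snd[OF lim]]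
    unfolding Zly \<xi>_def la_def yy_def by (simp_all add: o_def)
  have T: "0 < T j" "T \<longlonglongrightarrow> 0" for j
    using tpos LIMSEQ_subseq_LIMSEQ[OF tlim s] by (simp_all add: T_def[abs_def] o_def)
  have zs: "z (s j) = zb + T j *\<^sub>R \<zeta> (s j)" for j
    using tpos[of "s j"] by (simp add: \<zeta>_def T_def)
  have pts: "x (s j) = xb + T j *\<^sub>R \<xi> j" "lam (s j) = lb + T j *\<^sub>R la j" "Y (s j) = Yb + T j *\<^sub>R yy j" for j
    using zs[of j] unfolding z_def zb_def \<xi>_def la_def yy_def by (auto simp: prod_eq_iff)
  have Rlim: "(\<lambda>j. r (s j) / T j) \<longlonglongrightarrow> 0"
    using LIMSEQ_subseq_LIMSEQ[OF rlim s] by (simp add: T_def o_def)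
  note small = tendsto_scaled_null[OF T(1) Rlim]
  have rg: "(\<lambda>j. (1 / T j) *\<^sub>R lag_grad f1 h1 G1 (xb + T j *\<^sub>R \<xi> j) (lb + T j *\<^sub>R la j) (Yb + T j *\<^sub>R yy j)) \<longlonglongrightarrow> 0"
    unfolding pts[symmetric] by (rule small) (simp add: r_def res_def)
  have rh: "(\<lambda>j. (1 / T j) *\<^sub>R h (xb + T j *\<^sub>R \<xi> j)) \<longlonglongrightarrow> 0"
    unfolding pts[symmetric] by (rule small) (simp add: r_def res_def)
  have rc: "(\<lambda>j. (1 / T j) *\<^sub>R c1 (s j)) \<longlonglongrightarrow> 0" "(\<lambda>j. (1 / T j) *\<^sub>R c2 (s j)) \<longlonglongrightarrow> 0"
    by (rule small, simp add: r_def res_def)+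
  have PK: "G (xb + T j *\<^sub>R \<xi> j) - c1 (s j) \<in> K" for j
    using Q(2)[of "s j"] by (simp add: pts)
  have N: "Yb + T j *\<^sub>R yy j + c2 (s j) \<in> normal_cone K (G (xb + T j *\<^sub>R \<xi> j) - c1 (s j))" for j
    using Q(3)[of "s j"] by (simp add: pts)
  have "Z = 0" "l = 0" "y = 0"
    using linearized_KKT_trivial[OF K f2 h1 h2 G1 G2 feas mult SOSC SRCQ T dir rg rh rc PK N] by simp_all
  then show False using \<zeta>0 by (simp add: Zly)
qed

text \<open>The difference of two multipliers is represented through the constraint qualification.
  Stationarity of both annihilates the part from the derivatives and normality makes the product
  with \<open>W\<close> nonpositive, so the squared norm of the difference is nonpositive. This
  reduces the supremum in the second-order condition to a single multiplier.\<close>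

lemma multipliers_unique:
  fixes K :: "'a::euclidean_space set"
  assumes mult: "(lb, Yb) \<in> multipliers K f1 h1 G1 G xb"
    and SRCQ: "{(blinfun_apply (h1 xb) Z, blinfun_apply (G1 xb) Z + W) | Z W.
                 W \<in> tangent_cone K (G xb) \<inter> {W. inner W Yb = 0}} = UNIV"
  shows "multipliers K f1 h1 G1 G xb = {(lb, Yb)}"
proof -
  have "l = lb \<and> Y = Yb" if m: "(l, Y) \<in> multipliers K f1 h1 G1 G xb" for l Y
  proof -
    have "(l - lb, Y - Yb) \<in> {(blinfun_apply (h1 xb) Z, blinfun_apply (G1 xb) Z + W) | Z W.
                 W \<in> tangent_cone K (G xb) \<inter> {W. inner W Yb = 0}}"
      unfolding SRCQ by simp
    then obtain v W where vW: "l - lb = blinfun_apply (h1 xb) v" "Y - Yb = blinfun_apply (G1 xb) v + W"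
      "W \<in> tangent_cone K (G xb)" "inner Yb W = 0"
      by (auto simp: inner_commute)
    have "inner Y W \<le> 0"
      using m vW(3) unfolding multipliers_def by (auto intro: normal_cone_inner_tangent_le_0)
    moreover have "blinfun_apply (f1 xb) v + inner l (blinfun_apply (h1 xb) v) + inner Y (blinfun_apply (G1 xb) v) = 0"
      using m inner_lag_grad[of f1 h1 G1 xb l Y v] unfolding multipliers_def by auto
    moreover have "blinfun_apply (f1 xb) v + inner lb (blinfun_apply (h1 xb) v) + inner Yb (blinfun_apply (G1 xb) v) = 0"
      using mult inner_lag_grad[of f1 h1 G1 xb lb Yb v] unfolding multipliers_def by auto
    moreover have "inner (l - lb) (l - lb) + inner (Y - Yb) (Y - Yb)
        = inner (l - lb) (blinfun_apply (h1 xb) v) + inner (Y - Yb) (blinfun_apply (G1 xb) v + W)"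
      using vW(1,2) by simp
    ultimately have "inner (l - lb) (l - lb) + inner (Y - Yb) (Y - Yb) \<le> 0"
      using vW(4) by (simp add: inner_diff_left inner_add_right)
    then have "inner (l - lb) (l - lb) = 0" "inner (Y - Yb) (Y - Yb) = 0"
      using inner_ge_zero[of "l - lb"] inner_ge_zero[of "Y - Yb"] by linarith+
    then show ?thesis by simp
  qed
  then have "z = (lb, Yb)" if "z \<in> multipliers K f1 h1 G1 G xb" for z
    using that by (metis surj_pair)
  then show ?thesis using mult by blast
qed

section \<open>Projections expressed through normal cones, and the two solution maps\<close>

lemma closest_point_normal_cone:
  fixes K :: "'a::euclidean_space set"
  assumes "closed K" "convex K" "K \<noteq> {}"
  shows "closest_point K p \<in> K" "p - closest_point K p \<in> normal_cone K (closest_point K p)"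
proof -
  show "closest_point K p \<in> K" by (rule closest_point_in_set[OF assms(1,3)])
  show "p - closest_point K p \<in> normal_cone K (closest_point K p)"
    unfolding normal_cone_def using closest_point_dot[OF assms(2,1)] by simp
qed

lemma closest_point_eq_normal_cone:
  fixes K :: "'a::euclidean_space set"
  assumes "closed K" "convex K" "P \<in> K" "Y \<in> normal_cone K P"
  shows "closest_point K (P + Y) = P"
proof -
  have "inner Y (closest_point K (P + Y) - P) \<le> 0"
    using assms closest_point_in_set[of K "P + Y"] unfolding normal_cone_def by auto
  moreover have "inner (P + Y - closest_point K (P + Y)) (P - closest_point K (P + Y)) \<le> 0"
    using assms by (intro closest_point_dot)
  ultimately have "inner (P - closest_point K (P + Y)) (P - closest_point K (P + Y)) \<le> 0"
    by (simp add: algebra_simps)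
  then have "P - closest_point K (P + Y) = 0"
    using inner_ge_zero[of "P - closest_point K (P + Y)"]
    by (metis antisym inner_eq_zero_iff)
  then show ?thesis by simp
qed

theorem mainTheorem1:
  fixes k :: nat
    and f :: "('m::finite, 'n::finite) XX \<Rightarrow> real"
    and h :: "('m, 'n) XX \<Rightarrow> real^'p::finite"
    and G :: "('m, 'n) XX \<Rightarrow> ('m, 'n) XX"
    and f1 :: "('m, 'n) XX \<Rightarrow> ('m, 'n) XX \<Rightarrow>\<^sub>L real"
    and f2 :: "('m, 'n) XX \<Rightarrow> ('m, 'n) XX \<Rightarrow>\<^sub>L ('m, 'n) XX \<Rightarrow>\<^sub>L real"
    and h1 :: "('m, 'n) XX \<Rightarrow> ('m, 'n) XX \<Rightarrow>\<^sub>L (real^'p)"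
    and h2 :: "('m, 'n) XX \<Rightarrow> ('m, 'n) XX \<Rightarrow>\<^sub>L ('m, 'n) XX \<Rightarrow>\<^sub>L (real^'p)"
    and G1 :: "('m, 'n) XX \<Rightarrow> ('m, 'n) XX \<Rightarrow>\<^sub>L ('m, 'n) XX"
    and G2 :: "('m, 'n) XX \<Rightarrow> ('m, 'n) XX \<Rightarrow>\<^sub>L ('m, 'n) XX \<Rightarrow>\<^sub>L ('m, 'n) XX"
    and Xbar :: "('m, 'n) XX" and lambar :: "real^'p" and Ybar :: "('m, 'n) XX"
  assumes mn: "CARD('m) \<le> CARD('n)"
    and k: "1 \<le> k" "k \<le> CARD('m)"
    and f_C2: "C2_with f f1 f2" and h_C2: "C2_with h h1 h2" and G_C2: "C2_with G G1 G2"
    and feasible: "h Xbar = 0" "G Xbar \<in> kyfan_cone k"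
    and mult: "(lambar, Ybar) \<in> multipliers (kyfan_cone k) f1 h1 G1 G Xbar"
    and SOSC: "\<And>Z. Z \<in> critical_cone (kyfan_cone k) f1 h1 G1 G Xbar \<Longrightarrow> Z \<noteq> 0 \<Longrightarrow>
        (SUP (lam, Y)\<in>multipliers (kyfan_cone k) f1 h1 G1 G Xbar.
            ereal (lag_hess_quad f2 h2 G2 Xbar lam Y Z)
            - support_fun Y (second_tangent_set (kyfan_cone k) (G Xbar) (blinfun_apply (G1 Xbar) Z)))
        > 0"
    and SRCQ: "{(blinfun_apply (h1 Xbar) Z, blinfun_apply (G1 Xbar) Z + W) | Z W.
                 W \<in> tangent_cone (kyfan_cone k) (G Xbar) \<inter> {W. inner W Ybar = 0}} = UNIV"
  shows "loc_upper_lipschitz (J_map (kyfan_cone k) f1 h1 G1 h G) 0 (Xbar, lambar, Ybar)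
       \<and> loc_upper_lipschitz (J_tilde_map (kyfan_cone k) f1 h1 G1 h G) 0 (Xbar, lambar, Ybar)"
proof -
  let ?K = "kyfan_cone k :: ('m, 'n) XX set"
  let ?zb = "(Xbar, lambar, Ybar)"
  have cl: "closed ?K" and cv: "convex ?K" and orb: "orbit_regular ?K"
    using closed_kyfan_cone[OF mn k(2)] convex_kyfan_cone[OF mn k(2)] orbit_regular_kyfan_cone[OF mn k(2)]
    by blast+
  have ne: "?K \<noteq> {}" using feasible by blast
  have gr0: "lag_grad f1 h1 G1 Xbar lambar Ybar = 0" and Yb: "Ybar \<in> normal_cone ?K (G Xbar)"
    using mult unfolding multipliers_def by auto
  have SOSC': "inner Ybar w < lag_hess_quad f2 h2 G2 Xbar lambar Ybar Z"
    if Z: "Z \<in> critical_cone ?K f1 h1 G1 G Xbar" "Z \<noteq> 0"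
      and w: "w \<in> second_tangent_set ?K (G Xbar) (blinfun_apply (G1 Xbar) Z)" for Z w
  proof -
    let ?S = "support_fun Ybar (second_tangent_set ?K (G Xbar) (blinfun_apply (G1 Xbar) Z))"
    have le: "ereal (inner Ybar w) \<le> ?S"
      unfolding support_fun_def by (rule SUP_upper[OF w])
    have "0 < ereal (lag_hess_quad f2 h2 G2 Xbar lambar Ybar Z) - ?S"
      using SOSC[OF Z] unfolding multipliers_unique[OF mult SRCQ] by simp
    also have "\<dots> \<le> ereal (lag_hess_quad f2 h2 G2 Xbar lambar Ybar Z) - ereal (inner Ybar w)"
      by (rule ereal_minus_mono[OF order_refl le])
    finally show ?thesis by simp
  qed
  have der: "(f1 has_derivative blinfun_apply (f2 Xbar)) (at Xbar)"
    "(h has_derivative blinfun_apply (h1 Xbar)) (at Xbar)"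
    "(h1 has_derivative blinfun_apply (h2 Xbar)) (at Xbar)"
    "(G has_derivative blinfun_apply (G1 Xbar)) (at Xbar)"
    "(G1 has_derivative blinfun_apply (G2 Xbar)) (at Xbar)"
    using f_C2 h_C2 G_C2 unfolding C2_with_def by blast+
  obtain \<epsilon> \<mu> where \<epsilon>: "0 < \<epsilon>" and \<mu>: "0 \<le> \<mu>" and
    bound: "\<And>x lam Y c1 c2. dist (x, lam, Y) ?zb < \<epsilon> \<Longrightarrow> G x - c1 \<in> ?K \<Longrightarrow>
     Y + c2 \<in> normal_cone ?K (G x - c1) \<Longrightarrow>
     dist (x, lam, Y) ?zb \<le> \<mu> * (norm (lag_grad f1 h1 G1 x lam Y) + norm (h x) + norm c1 + norm c2)"
    using KKT_error_bound[OF cl orb der feasible mult SOSC' SRCQ] by blast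
  \<comment> \<open>Common treatment of the two solution maps: each provides a normal cone inclusion
    whose multiplier shift is bounded by \<open>norm dG\<close>.\<close>
  have lip: "loc_upper_lipschitz S 0 ?zb"
    if zb: "?zb \<in> S 0" and S: "\<And>df dh dG x lam Y. (x, lam, Y) \<in> S (df, dh, dG) \<Longrightarrow>
      lag_grad f1 h1 G1 x lam Y = df \<and> h x = dh \<and> G x - dG \<in> ?K \<and>
      (\<exists>c2. norm c2 \<le> norm dG \<and> Y + c2 \<in> normal_cone ?K (G x - dG))"
    for S :: "('m, 'n) XX \<times> (real^'p) \<times> ('m, 'n) XX \<Rightarrow> (('m, 'n) XX \<times> (real^'p) \<times> ('m, 'n) XX) set"
  proof -
    have main: "dist z ?zb \<le> (4 * \<mu>) * norm \<delta>" if z: "z \<in> S \<delta>" "dist z ?zb < \<epsilon>" for z \<delta>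
    proof -
      obtain x lam Y where zeq: "z = (x, lam, Y)" by (cases z)
      obtain df dh dG where deq: "\<delta> = (df, dh, dG)" by (cases \<delta>)
      obtain c2 where eqs: "lag_grad f1 h1 G1 x lam Y = df" "h x = dh" "G x - dG \<in> ?K"
        "norm c2 \<le> norm dG" "Y + c2 \<in> normal_cone ?K (G x - dG)"
        using S z(1) unfolding zeq deq by blast
      have n: "norm df \<le> norm \<delta>" "norm dh \<le> norm \<delta>" "norm dG \<le> norm \<delta>"
        unfolding deq by (meson norm_fst_le norm_snd_le order_trans)+
      have "dist z ?zb \<le> \<mu> * (norm df + norm dh + norm dG + norm c2)"
        using bound[of x lam Y dG c2] z(2) eqs unfolding zeq by simp
      \<comment> \<open>Each of the four residual norms is at most
        \<open>norm \<delta>\<close>.\<close>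
      also have "\<dots> \<le> \<mu> * (4 * norm \<delta>)"
        using n eqs(4) \<mu> by (intro mult_left_mono) linarith+
      finally show ?thesis by (simp add: mult_ac)
    qed
    have "ball ?zb \<epsilon> \<inter> S 0 = {?zb}"
      using main[of _ 0] zb \<epsilon> by (auto simp: dist_commute)
    moreover have "S \<delta> \<inter> ball ?zb \<epsilon> \<subseteq> cball ?zb (4 * \<mu> * norm (\<delta> - 0))" for \<delta>
    proof
      fix z assume "z \<in> S \<delta> \<inter> ball ?zb \<epsilon>"
      then have "dist z ?zb \<le> 4 * \<mu> * norm \<delta>" by (intro main) (simp_all add: dist_commute)
      then show "z \<in> cball ?zb (4 * \<mu> * norm (\<delta> - 0))" by (simp add: dist_commute)
    qed
    ultimately show ?thesis
      unfolding loc_upper_lipschitz_def using zb \<mu> \<epsilon>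
      by (intro conjI exI[of _ "4 * \<mu>"] exI[of _ UNIV] exI[of _ "ball ?zb \<epsilon>"]) auto
  qed
  have zero3: "(0 :: ('m, 'n) XX \<times> (real^'p) \<times> ('m, 'n) XX) = (0, 0, 0)"
    by (simp add: prod_eq_iff)
  have cp: "closest_point ?K (G Xbar + Ybar) = G Xbar"
    by (rule closest_point_eq_normal_cone[OF cl cv feasible(2) Yb])
  have "loc_upper_lipschitz (J_map ?K f1 h1 G1 h G) 0 ?zb"
  proof (rule lip)
    show "?zb \<in> J_map ?K f1 h1 G1 h G 0"
      using gr0 feasible cp by (simp add: J_map_def Psi_map_def zero3)
  next
    fix df dh dG x lam Y
    assume "(x, lam, Y) \<in> J_map ?K f1 h1 G1 h G (df, dh, dG)"
    then have e: "lag_grad f1 h1 G1 x lam Y = df" "h x = dh" "G x - closest_point ?K (G x + Y) = dG"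
      by (auto simp: J_map_def Psi_map_def)
    have P: "G x - dG = closest_point ?K (G x + Y)" using e(3) by auto
    \<comment> \<open>The perturbation moves the value of the projection but not its argument, so
      the normal obtained is \<open>Y + dG\<close> and \<open>c2 = dG\<close>.\<close>
    have "G x + Y - (G x - dG) = Y + dG" by simp
    then have "Y + dG \<in> normal_cone ?K (G x - dG)"
      using closest_point_normal_cone(2)[OF cl cv ne, of "G x + Y"] unfolding P[symmetric] by simp
    moreover have "G x - dG \<in> ?K"
      unfolding P by (rule closest_point_normal_cone(1)[OF cl cv ne])
    ultimately show "lag_grad f1 h1 G1 x lam Y = df \<and> h x = dh \<and> G x - dG \<in> ?K \<and>
      (\<exists>c2. norm c2 \<le> norm dG \<and> Y + c2 \<in> normal_cone ?K (G x - dG))"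
      using e by blast
  qed
  moreover have "loc_upper_lipschitz (J_tilde_map ?K f1 h1 G1 h G) 0 ?zb"
  proof (rule lip)
    show "?zb \<in> J_tilde_map ?K f1 h1 G1 h G 0"
      using gr0 feasible cp by (simp add: J_tilde_map_def Psi_tilde_map_def zero3)
  next
    fix df dh dG x lam Y
    assume "(x, lam, Y) \<in> J_tilde_map ?K f1 h1 G1 h G (df, dh, dG)"
    then have e: "lag_grad f1 h1 G1 x lam Y = df" "h x = dh"
      "G x - dG = closest_point ?K (G x - dG + Y)"
      by (simp_all add: J_tilde_map_def Psi_tilde_map_def zero3)
    have "G x - dG \<in> ?K" using closest_point_normal_cone(1)[OF cl cv ne] e(3) by metis
    \<comment> \<open>The perturbation enters the argument and the value of the projection alike and
      cancels: \<open>Y\<close> itself is normal, so \<open>c2 = 0\<close>.\<close>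
    moreover have "G x - dG + Y - (G x - dG) \<in> normal_cone ?K (G x - dG)"
      using closest_point_normal_cone(2)[OF cl cv ne, of "G x - dG + Y"] unfolding e(3)[symmetric] .
    then have "Y + 0 \<in> normal_cone ?K (G x - dG)" by simp
    ultimately show "lag_grad f1 h1 G1 x lam Y = df \<and> h x = dh \<and> G x - dG \<in> ?K \<and>
      (\<exists>c2. norm c2 \<le> norm dG \<and> Y + c2 \<in> normal_cone ?K (G x - dG))"
      using e by (metis norm_ge_zero norm_zero)
  qed
  ultimately show ?thesis by blast
qed

end
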